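(* Let $n\ge 2$ be an integer and let $a\in(0,1)$. Then for all sufficiently small $d>0$ (i.e., there is $d_0>0$ such that for every $d\in(0,d_0)$) the lattice Nagumo equation $$\dot u_i(t)=d\big(u_{i-1}(t)-2u_i(t)+u_{i+1}(t)\big)+g(u_i(t);a),\qquad i\in\mathbb{Z},\ t\in\mathbb{R},$$ with $g(u;a)=u(1-u)(u-a)$, has exactly: 1. $3^n$ $n$-periodic stationary solutions, which form (a) $N_3(n)$ equivalence classes with respect to translations; moreover, $L_3(n)$ of these equivalence classes are formed by primitive periodic solutions; (b) $B_3(n)$ equivalence classes with respect to translations and reflections; moreover, $BL_3(n)$ of these equivalence classes are formed by primitive periodic solutions. 2. $2^n$ asymptotically stable $n$-periodic stationary solutions, which form (a) $N_2(n)$ equivalence classes with respect to translations; moreover, $L_2(n)$ of these equivalence classes are formed by primitive periodic solutions; (b) $B_2(n)$ equivalence classes with respect to translations and reflections; moreover, $BL_2(n)$ of these equivalence classes are formed by primitive periodic solutions.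
   Context: A stationary solution is a real double sequence $u=(u_i)_{i\in\mathbb{Z}}$ with $d(u_{i-1}-2u_i+u_{i+1})+g(u_i;a)=0$ for all $i\in\mathbb{Z}$. It is $n$-periodic if $u_{i+n}=u_i$ for all $i$ ($n$ need not be the smallest period; in particular constant solutions are $n$-periodic). An $n$-periodic solution is primitive if $n$ is its smallest period. The lattice equation is considered as an evolution equation on $\ell^\infty(\mathbb{Z};\mathbb{R})$, and asymptotic stability of a stationary solution is understood with respect to the $\ell^\infty$-norm. Symmetries: if $(u_i)_{i\in\mathbb Z}$ is an $n$-periodic stationary solution, then so are its translations $(u_{i+\ell})_{i\in\mathbb{Z}}$, $\ell\in\mathbb{Z}$, and its reflection $(u_{1-i})_{i\in\mathbb{Z}}$. Two $n$-periodic stationary solutions are equivalent with respect to translations if one is a translation of the other; they are equivalent with respect to translations and reflections if one is obtained from the other by a composition of translations and the reflection. For integers $k,n\ge 1$, with $\varphi$ Euler's totient function and $\mu$ the Möbius function, and sums over positive divisors $m$ of $n$, define $$N_k(n)=\frac1n\sum_{m\mid n}\varphi(m)\,k^{n/m},\qquad L_k(n)=\frac1n\sum_{m\mid n}\mu(m)\,k^{n/m},$$ $$B_k(n)=\begin{cases}\frac12\left(N_k(n)+\frac{k+1}{2}k^{n/2}\right)& n\text{ even},\\[2pt] \frac12\left(N_k(n)+k^{(n+1)/2}\right)& n\text{ odd},\end{cases}\qquad BL_k(n)=\sum_{m\mid n}\mu(m)\,B_k(n/m).$$ *)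

theory Defs
  imports
    "HOL-Analysis.Analysis"
    "HOL-Number_Theory.Number_Theory"
    "HOL-Computational_Algebra.Squarefree"
begin

section \<open>Asymptotic stability\<close>

definition solves_from ::
  "('v \<Rightarrow> 'v) \<Rightarrow> 'v \<Rightarrow> (real \<Rightarrow> 'v::real_normed_vector) \<Rightarrow> bool" where
  "solves_from F x0 x \<longleftrightarrow>
     x 0 = x0 \<and> (\<forall>t\<ge>0. (x has_vector_derivative F (x t)) (at t within {0..}))"

text \<open>Existence of a forward solution is demanded for initial values close to \<open>p\<close>, so that
  neither condition can hold vacuously.\<close>

definition lyapunov_stable :: "('v \<Rightarrow> 'v) \<Rightarrow> 'v::real_normed_vector \<Rightarrow> bool" where
  "lyapunov_stable F p \<longleftrightarrow>
     (\<forall>\<epsilon>>0. \<exists>\<delta>>0. \<forall>x0. norm (x0 - p) < \<delta> \<longrightarrow>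
        (\<exists>x. solves_from F x0 x) \<and>
        (\<forall>x. solves_from F x0 x \<longrightarrow> (\<forall>t\<ge>0. norm (x t - p) < \<epsilon>)))"

definition locally_attractive :: "('v \<Rightarrow> 'v) \<Rightarrow> 'v::real_normed_vector \<Rightarrow> bool" where
  "locally_attractive F p \<longleftrightarrow>
     (\<exists>\<delta>>0. \<forall>x0. norm (x0 - p) < \<delta> \<longrightarrow>
        (\<exists>x. solves_from F x0 x) \<and>
        (\<forall>x. solves_from F x0 x \<longrightarrow> (x \<longlongrightarrow> p) at_top))"

definition asymptotically_stable :: "('v \<Rightarrow> 'v) \<Rightarrow> 'v::real_normed_vector \<Rightarrow> bool" where
  "asymptotically_stable F p \<longleftrightarrow> F p = 0 \<and> lyapunov_stable F p \<and> locally_attractive F p"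

section \<open>The lattice Nagumo equation\<close>

definition nagumo_g :: "real \<Rightarrow> real \<Rightarrow> real" where
  "nagumo_g u a = u * (1 - u) * (u - a)"

definition lattice_rhs :: "real \<Rightarrow> real \<Rightarrow> (int \<Rightarrow> real) \<Rightarrow> int \<Rightarrow> real" where
  "lattice_rhs d a u i = d * (u (i - 1) - 2 * u i + u (i + 1)) + nagumo_g (u i) a"

lemma bcontfun_int_iff:
  fixes u :: "int \<Rightarrow> real"
  shows "u \<in> bcontfun \<longleftrightarrow> bounded (range u)"
  by (simp add: bcontfun_def)

lemma lattice_rhs_bcontfun:
  assumes "u \<in> bcontfun"
  shows "lattice_rhs d a u \<in> bcontfun"
proof -
  from assms obtain B where B: "\<And>i. \<bar>u i\<bar> \<le> B"
    by (auto simp: bcontfun_int_iff bounded_iff)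
  have B0: "0 \<le> B"
    using B[of 0] by linarith
  have "\<bar>lattice_rhs d a u i\<bar> \<le> \<bar>d\<bar> * (4 * B) + B * (1 + B) * (B + \<bar>a\<bar>)" for i
  proof -
    have "\<bar>u (i - 1) - 2 * u i + u (i + 1)\<bar> \<le> 4 * B"
      using B[of "i - 1"] B[of i] B[of "i + 1"] by linarith
    then have 1: "\<bar>d * (u (i - 1) - 2 * u i + u (i + 1))\<bar> \<le> \<bar>d\<bar> * (4 * B)"
      by (simp add: abs_mult mult_left_mono)
    have "\<bar>u i\<bar> * \<bar>1 - u i\<bar> * \<bar>u i - a\<bar> \<le> B * (1 + B) * (B + \<bar>a\<bar>)"
      using B[of i] B0 by (intro mult_mono) auto
    then have 2: "\<bar>nagumo_g (u i) a\<bar> \<le> B * (1 + B) * (B + \<bar>a\<bar>)"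
      by (simp add: nagumo_g_def abs_mult)
    show ?thesis
      using abs_triangle_ineq 1 2 unfolding lattice_rhs_def by (meson add_mono order_trans)
  qed
  then show ?thesis
    by (auto simp: bcontfun_int_iff bounded_iff)
qed

text \<open>Since the integers are discrete, \<open>int \<Rightarrow>\<^sub>C real\<close> is the space of all bounded double
  sequences with the supremum norm.\<close>

definition nagumo_field :: "real \<Rightarrow> real \<Rightarrow> (int \<Rightarrow>\<^sub>C real) \<Rightarrow> (int \<Rightarrow>\<^sub>C real)" where
  "nagumo_field d a U = Bcontfun (lattice_rhs d a (apply_bcontfun U))"

lemma apply_nagumo_field: "apply_bcontfun (nagumo_field d a U) = lattice_rhs d a (apply_bcontfun U)"
  unfolding nagumo_field_def by (intro Bcontfun_inverse lattice_rhs_bcontfun apply_bcontfun)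

definition stationary :: "real \<Rightarrow> real \<Rightarrow> (int \<Rightarrow> real) \<Rightarrow> bool" where
  "stationary d a u \<longleftrightarrow> (\<forall>i. lattice_rhs d a u i = 0)"

lemma nagumo_field_eq_0_iff: "nagumo_field d a U = 0 \<longleftrightarrow> stationary d a (apply_bcontfun U)"
proof
  assume "nagumo_field d a U = 0"
  then have "apply_bcontfun (nagumo_field d a U) i = 0" for i
    by simp
  then show "stationary d a (apply_bcontfun U)"
    by (simp add: apply_nagumo_field stationary_def)
next
  assume "stationary d a (apply_bcontfun U)"
  then show "nagumo_field d a U = 0"
    by (intro bcontfun_eqI) (simp add: apply_nagumo_field stationary_def)
qed

definition periodic :: "nat \<Rightarrow> (int \<Rightarrow> real) \<Rightarrow> bool" where
  "periodic n u \<longleftrightarrow> (\<forall>i. u (i + int n) = u i)"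

definition primitive :: "nat \<Rightarrow> (int \<Rightarrow> real) \<Rightarrow> bool" where
  "primitive n u \<longleftrightarrow> n > 0 \<and> periodic n u \<and> (\<forall>m. 0 < m \<and> m < n \<longrightarrow> \<not> periodic m u)"

definition periodic_stationary :: "real \<Rightarrow> real \<Rightarrow> nat \<Rightarrow> (int \<Rightarrow> real) set" where
  "periodic_stationary d a n = {u. stationary d a u \<and> periodic n u}"

definition stable_periodic_stationary :: "real \<Rightarrow> real \<Rightarrow> nat \<Rightarrow> (int \<Rightarrow> real) set" where
  "stable_periodic_stationary d a n =
     {u \<in> periodic_stationary d a n.
        \<exists>U. apply_bcontfun U = u \<and> asymptotically_stable (nagumo_field d a) U}"

section \<open>Symmetries and equivalence classes\<close>

definition translate :: "int \<Rightarrow> (int \<Rightarrow> real) \<Rightarrow> int \<Rightarrow> real" where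
  "translate l u = (\<lambda>i. u (i + l))"

definition reflect :: "(int \<Rightarrow> real) \<Rightarrow> int \<Rightarrow> real" where
  "reflect u = (\<lambda>i. u (1 - i))"

inductive trans_refl_equiv :: "(int \<Rightarrow> real) \<Rightarrow> (int \<Rightarrow> real) \<Rightarrow> bool" for u where
  base: "trans_refl_equiv u u"
| translate: "trans_refl_equiv u v \<Longrightarrow> trans_refl_equiv u (translate l v)"
| reflect: "trans_refl_equiv u v \<Longrightarrow> trans_refl_equiv u (reflect v)"

definition trans_rel :: "(int \<Rightarrow> real) set \<Rightarrow> ((int \<Rightarrow> real) \<times> (int \<Rightarrow> real)) set" where
  "trans_rel S = {(u, v). u \<in> S \<and> v \<in> S \<and> (\<exists>l. v = translate l u)}"

definition trans_refl_rel :: "(int \<Rightarrow> real) set \<Rightarrow> ((int \<Rightarrow> real) \<times> (int \<Rightarrow> real)) set" where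
  "trans_refl_rel S = {(u, v). u \<in> S \<and> v \<in> S \<and> trans_refl_equiv u v}"

lemma translate_translate: "translate k (translate l u) = translate (k + l) u"
  by (simp add: translate_def add.assoc)

lemma translate_0: "translate 0 u = u"
  by (simp add: translate_def)

lemma reflect_reflect: "reflect (reflect u) = u"
  by (simp add: reflect_def)

lemma equiv_trans_rel: "equiv S (trans_rel S)"
proof (rule equivI)
  show "trans_rel S \<subseteq> S \<times> S"
    by (auto simp: trans_rel_def)
  show "refl_on S (trans_rel S)"
    unfolding refl_on_def trans_rel_def by (auto intro: exI[of _ 0] simp: translate_0)
  show "sym (trans_rel S)"
  proof (rule symI)
    fix u v assume "(u, v) \<in> trans_rel S"
    then obtain l where "u \<in> S" "v \<in> S" "v = translate l u"
      by (auto simp: trans_rel_def)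
    moreover from this have "u = translate (- l) v"
      by (simp add: translate_translate translate_0)
    ultimately show "(v, u) \<in> trans_rel S"
      unfolding trans_rel_def by blast
  qed
  show "trans (trans_rel S)"
    unfolding trans_def trans_rel_def by (auto simp: translate_translate)
qed

lemma trans_refl_equiv_trans:
  assumes "trans_refl_equiv v w" "trans_refl_equiv u v"
  shows "trans_refl_equiv u w"
  using assms by induction (auto intro: trans_refl_equiv.intros)

lemma trans_refl_equiv_sym: "trans_refl_equiv u v \<Longrightarrow> trans_refl_equiv v u"
proof (induction rule: trans_refl_equiv.induct)
  case base
  show ?case by (rule trans_refl_equiv.base)
next
  case (translate v l)
  have "trans_refl_equiv (translate l v) (translate (- l) (translate l v))"
    by (intro trans_refl_equiv.intros)
  then have "trans_refl_equiv (translate l v) v"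
    by (simp add: translate_translate translate_0)
  with translate.IH show ?case
    by (rule trans_refl_equiv_trans)
next
  case (reflect v)
  have "trans_refl_equiv (reflect v) (reflect (reflect v))"
    by (intro trans_refl_equiv.intros)
  then have "trans_refl_equiv (reflect v) v"
    by (simp add: reflect_reflect)
  with reflect.IH show ?case
    by (rule trans_refl_equiv_trans)
qed

lemma equiv_trans_refl_rel: "equiv S (trans_refl_rel S)"
proof (rule equivI)
  show "trans_refl_rel S \<subseteq> S \<times> S"
    by (auto simp: trans_refl_rel_def)
  show "refl_on S (trans_refl_rel S)"
    by (auto simp: refl_on_def trans_refl_rel_def intro: trans_refl_equiv.base)
  show "sym (trans_refl_rel S)"
    by (auto simp: sym_def trans_refl_rel_def intro: trans_refl_equiv_sym)
  show "trans (trans_refl_rel S)"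
    by (auto simp: trans_def trans_refl_rel_def intro: trans_refl_equiv_trans)
qed

definition primitive_classes :: "nat \<Rightarrow> (int \<Rightarrow> real) set set \<Rightarrow> (int \<Rightarrow> real) set set" where
  "primitive_classes n Q = {C \<in> Q. \<forall>u\<in>C. primitive n u}"

section \<open>Counting functions\<close>

definition moebius_mu :: "nat \<Rightarrow> int" where
  "moebius_mu m = (if squarefree m then (- 1) ^ card (prime_factors m) else 0)"

definition necklaces :: "nat \<Rightarrow> nat \<Rightarrow> real" where
  "necklaces k n = (1 / real n) * (\<Sum>m | m dvd n. real (totient m) * real k ^ (n div m))"

definition lyndon_words :: "nat \<Rightarrow> nat \<Rightarrow> real" where
  "lyndon_words k n = (1 / real n) * (\<Sum>m | m dvd n. real_of_int (moebius_mu m) * real k ^ (n div m))"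

definition bracelets :: "nat \<Rightarrow> nat \<Rightarrow> real" where
  "bracelets k n =
     (if even n then (1 / 2) * (necklaces k n + (real k + 1) / 2 * real k ^ (n div 2))
      else (1 / 2) * (necklaces k n + real k ^ ((n + 1) div 2)))"

definition lyndon_bracelets :: "nat \<Rightarrow> nat \<Rightarrow> real" where
  "lyndon_bracelets k n = (\<Sum>m | m dvd n. real_of_int (moebius_mu m) * bracelets k (n div m))"

end

theory Submission
  imports Defs
begin

text \<open>Without coupling, the stationary sequences are exactly the sequences with values in the zero set
  \<open>{0, a, 1}\<close> of \<open>g\<close>. These zeros are simple, so for small \<open>d\<close> every such word \<open>w\<close> is continued
  by exactly one stationary sequence that stays uniformly close to \<open>w\<close>: it is the fixed point of a
  simplified Newton map, which is a contraction in the supremum norm. Conversely, a discrete maximum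
  principle confines a periodic stationary sequence to \<open>[0, 1]\<close>; there the coupling is at most \<open>2 * d\<close>,
  so \<open>g\<close> is small along the sequence, and every entry is close to a zero of \<open>g\<close>. Since the
  continuation is unique, it commutes with translations and with the reflection and preserves
  periods. The \<open>n\<close>-periodic stationary solutions therefore correspond to the \<open>n\<close>-periodic words over
  three letters, with all symmetries (\<open>periodic_stationary_eq\<close>).

  The derivative of \<open>g\<close> is negative at \<open>0\<close> and \<open>1\<close> and positive at \<open>a\<close>. If a word avoids \<open>a\<close>, an
  explicit Euler step of the lattice equation is a contraction near its continuation \<open>p\<close>. The equation
  then reads \<open>x' = (P x - x) / h\<close> with a contraction \<open>P\<close> that fixes \<open>p\<close>; variation of constants yields
  global solutions near \<open>p\<close> and exponential decay towards \<open>p\<close>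
  (\<open>contraction_step_imp_asymptotically_stable\<close>). If a word takes the value \<open>a\<close> at \<open>k\<close>, raise its
  continuation by a small constant. The difference to the continuation then satisfies a cooperative
  system, so it stays nonnegative, and its entry at \<open>k\<close> grows exponentially (\<open>solution_unstable\<close>).
  The stable solutions thus correspond to the words over the two letters \<open>0\<close> and \<open>1\<close>
  (\<open>stable_periodic_stationary_eq\<close>).

  Periodic words are counted up to symmetry by Burnside's argument for the cyclic group of order
  \<open>n\<close> and the dihedral group of order \<open>2 * n\<close> (\<open>orbit_count\<close>). A translation by \<open>l\<close> fixes the words
  of period \<open>gcd l n\<close>, a reflection fixes the words that are palindromic about its axis. Every
  \<open>n\<close>-periodic word is primitive for exactly one divisor of \<open>n\<close>, so Moebius inversion gives the
  numbers of primitive classes; \<open>class_counts\<close> transports all numbers along the continuation.\<close>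

section \<open>Orbit counting\<close>

text \<open>The index set \<open>I\<close> stands for a group that may act with a kernel, as the dihedral group of order
  \<open>2 * n\<close> does for \<open>n = 1\<close> and \<open>n = 2\<close>. All that matters of its multiplication is the bijection
  \<open>\<psi>\<close>, left multiplication by \<open>j\<close>: it carries the stabilizer of \<open>u\<close> onto the indices that
  send \<open>u\<close> to \<open>act j u\<close>. All fibres of \<open>\<lambda>i. act i u\<close> over the orbit thus have the same size.\<close>

lemma orbit_stabilizer_count:
  fixes act :: "'i \<Rightarrow> 'a \<Rightarrow> 'a"
  assumes I: "finite I" and closed: "\<And>i u. i \<in> I \<Longrightarrow> u \<in> S \<Longrightarrow> act i u \<in> S"
    and inj: "\<And>i. i \<in> I \<Longrightarrow> inj_on (act i) S"
    and mult: "\<And>j. j \<in> I \<Longrightarrow> \<exists>\<psi>. bij_betw \<psi> I I \<and> (\<forall>i\<in>I. \<forall>u\<in>S. act (\<psi> i) u = act j (act i u))"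
    and u: "u \<in> S"
  shows "card ((\<lambda>i. act i u) ` I) * card {i \<in> I. act i u = u} = card I"
proof -
  have same: "card {i \<in> I. act i u = v} = card {i \<in> I. act i u = u}" if "v \<in> (\<lambda>i. act i u) ` I" for v
  proof -
    obtain j where j: "j \<in> I" "v = act j u" using \<open>v \<in> _\<close> by blast
    obtain \<psi> where \<psi>: "bij_betw \<psi> I I" "\<And>i. i \<in> I \<Longrightarrow> act (\<psi> i) u = act j (act i u)"
      using mult[OF j(1)] u by blast
    have iff: "act (\<psi> i) u = v \<longleftrightarrow> act i u = u" if "i \<in> I" for i
      using \<psi>(2)[OF that] inj_onD[OF inj[OF j(1)], of "act i u" u] closed[OF that u] u j(2) by auto
    have "\<psi> ` I = I" using \<psi>(1) by (simp add: bij_betw_def)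
    then have "{i \<in> I. act i u = v} = \<psi> ` {i \<in> I. act (\<psi> i) u = v}" by auto
    also have "{i \<in> I. act (\<psi> i) u = v} = {i \<in> I. act i u = u}" using iff by auto
    finally have "{i \<in> I. act i u = v} = \<psi> ` {i \<in> I. act i u = u}" .
    moreover have "inj_on \<psi> {i \<in> I. act i u = u}"
      using \<psi>(1) by (auto simp: bij_betw_def inj_on_def)
    ultimately show ?thesis by (simp add: card_image)
  qed
  have "card I = (\<Sum>v\<in>(\<lambda>i. act i u) ` I. card {i \<in> I. act i u = v})"
    using sum.group[of I "(\<lambda>i. act i u) ` I" "\<lambda>i. act i u" "\<lambda>_. 1 :: nat"] I by simp
  also have "\<dots> = (\<Sum>v\<in>(\<lambda>i. act i u) ` I. card {i \<in> I. act i u = u})"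
    by (rule sum.cong) (use same in auto)
  finally show ?thesis by simp
qed

text \<open>Burnside's lemma: the pairs \<open>(i, u)\<close> with \<open>act i u = u\<close> are counted once by \<open>i\<close> and once by
  \<open>u\<close>. In the second count every element of an orbit \<open>C\<close> contributes \<open>card I / card C\<close>, hence
  every orbit contributes \<open>card I\<close>.\<close>

lemma orbit_count:
  fixes act :: "'i \<Rightarrow> 'a \<Rightarrow> 'a"
  assumes I: "finite I" and S: "finite S"
    and closed: "\<And>i u. i \<in> I \<Longrightarrow> u \<in> S \<Longrightarrow> act i u \<in> S"
    and inj: "\<And>i. i \<in> I \<Longrightarrow> inj_on (act i) S"
    and mult: "\<And>j. j \<in> I \<Longrightarrow> \<exists>\<psi>. bij_betw \<psi> I I \<and> (\<forall>i\<in>I. \<forall>u\<in>S. act (\<psi> i) u = act j (act i u))"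
    and e: "e \<in> I" "\<And>u. u \<in> S \<Longrightarrow> act e u = u"
  shows "card ((\<lambda>u. (\<lambda>i. act i u) ` I) ` S) * card I = (\<Sum>i\<in>I. card {u \<in> S. act i u = u})"
proof -
  define orb where "orb u = (\<lambda>i. act i u) ` I" for u
  have self: "u \<in> orb u" if "u \<in> S" for u
    using e that by (force simp: orb_def)
  have sub: "orb v \<subseteq> orb u" if u: "u \<in> S" and v: "v \<in> orb u" for u v
  proof
    fix w assume "w \<in> orb v"
    then obtain j i where ji: "j \<in> I" "i \<in> I" "w = act j (act i u)"
      using v by (auto simp: orb_def)
    obtain \<psi> where "bij_betw \<psi> I I" "act (\<psi> i) u = act j (act i u)"
      using mult[OF ji(1)] ji(2) u by blast
    then have "\<psi> i \<in> I" "w = act (\<psi> i) u"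
      using ji by (auto simp: bij_betw_def)
    then show "w \<in> orb u" by (auto simp: orb_def)
  qed
  have sym: "u \<in> orb v" if u: "u \<in> S" and v: "v \<in> orb u" for u v
  proof -
    obtain j where j: "j \<in> I" "v = act j u" using v by (auto simp: orb_def)
    obtain \<psi> where \<psi>: "bij_betw \<psi> I I" "\<forall>i\<in>I. \<forall>u\<in>S. act (\<psi> i) u = act j (act i u)"
      using mult[OF j(1)] by blast
    obtain i where i: "i \<in> I" "\<psi> i = e"
      using \<psi>(1) e(1) by (metis bij_betw_imp_surj_on imageE)
    have vS: "v \<in> S" using closed j u by simp
    have "act j (act i v) = act j u"
      using \<psi>(2) i e(2) vS j(2) by metis
    then have "act i v = u"
      using inj_onD[OF inj[OF j(1)]] closed[OF i(1) vS] u by blast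
    then show ?thesis using i by (auto simp: orb_def)
  qed
  have orbS: "orb u \<subseteq> S" if "u \<in> S" for u
    using closed that by (auto simp: orb_def)
  have eq: "orb v = orb u" if "u \<in> S" "v \<in> orb u" for u v
    using sub[of u v] sub[of v u] sym[of u v] orbS[of u] that by blast
  have orb_class: "{v \<in> S. orb v = orb u} = orb u" if "u \<in> S" for u
    using eq[of u] self orbS that by blast
  have "real (\<Sum>i\<in>I. card {u \<in> S. act i u = u}) = real (\<Sum>u\<in>S. card {i \<in> I. act i u = u})"
    using sum.swap_restrict[OF I S, of "\<lambda>_ _. 1 :: nat" "\<lambda>i u. act i u = u"] by simp
  also have "\<dots> = (\<Sum>u\<in>S. real (card {i \<in> I. act i u = u}))" by simp
  also have "\<dots> = (\<Sum>C\<in>orb ` S. \<Sum>u\<in>{v \<in> S. orb v = C}. real (card {i \<in> I. act i u = u}))"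
    by (rule sum.group[symmetric]) (use S in auto)
  also have "\<dots> = (\<Sum>C\<in>orb ` S. real (card I))"
  proof (rule sum.cong[OF refl])
    fix C assume "C \<in> orb ` S"
    then obtain u where u: "u \<in> S" "C = orb u" by blast
    have C: "finite C" "C \<noteq> {}" using self u I by (auto simp: orb_def)
    have "real (card {i \<in> I. act i v = v}) = real (card I) / real (card C)" if "v \<in> C" for v
    proof -
      have "v \<in> S" "orb v = C" using that u orbS[of u] eq[of u v] by auto
      then have "card C * card {i \<in> I. act i v = v} = card I"
        using orbit_stabilizer_count[of I S act v, OF I closed inj mult] by (simp add: orb_def)
      then show ?thesis using C by (simp add: card_gt_0_iff nonzero_eq_divide_eq mult.commute flip: of_nat_mult)
    qed
    then have "(\<Sum>v\<in>C. real (card {i \<in> I. act i v = v})) = (\<Sum>v\<in>C. real (card I) / real (card C))"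
      by (rule sum.cong[OF refl])
    also have "\<dots> = real (card I)" using C by simp
    finally show "(\<Sum>u\<in>{v \<in> S. orb v = C}. real (card {i \<in> I. act i u = u})) = real (card I)"
      using orb_class u by simp
  qed
  also have "\<dots> = real (card (orb ` S) * card I)" by simp
  finally show ?thesis unfolding orb_def of_nat_eq_iff by simp
qed

section \<open>Moebius inversion\<close>

lemma moebius_mu_prime_mult:
  assumes p: "prime p" "\<not> p dvd d" "squarefree d"
  shows "moebius_mu (p * d) = - moebius_mu d"
proof -
  have "d \<noteq> 0" using p(3) by (metis not_squarefree_0)
  have "coprime p d" using p by (simp add: prime_imp_coprime)
  then have "squarefree (p * d)"
    using p by (simp add: squarefree_mult_coprime squarefree_prime)
  moreover have "prime_factors (p * d) = insert p (prime_factors d)"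
    using p \<open>d \<noteq> 0\<close> by (simp add: prime_factors_product prime_prime_factors)
  moreover have "p \<notin> prime_factors d" using p by auto
  ultimately show ?thesis using p by (simp add: moebius_mu_def)
qed

text \<open>For \<open>n > 1\<close> choose a prime divisor \<open>p\<close> of \<open>n\<close>. The squarefree divisors of \<open>n\<close> come in pairs
  \<open>d\<close>, \<open>p * d\<close> with \<open>d\<close> prime to \<open>p\<close>, and the two contributions cancel.\<close>

lemma sum_moebius_mu_divisors:
  assumes "n > 0"
  shows "(\<Sum>d | d dvd n. moebius_mu d) = (if n = 1 then 1 else 0)"
proof (cases "n = 1")
  case True
  then have "{d. d dvd n} = {1}" by auto
  then show ?thesis using True by (simp add: moebius_mu_def)
next
  case False
  then obtain p where p: "prime p" "p dvd n"
    using prime_factor_nat by blast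
  define A where "A = {d. d dvd n \<and> squarefree d \<and> \<not> p dvd d}"
  have fin: "finite {d. d dvd n}" using assms by simp
  then have finA: "finite A" by (rule finite_subset[rotated]) (auto simp: A_def)
  have p0: "p > 0" using p by (simp add: prime_gt_0_nat)
  have split: "{d. d dvd n \<and> squarefree d} = A \<union> (*) p ` A"
  proof (intro Set.set_eqI iffI)
    fix d assume d: "d \<in> {d. d dvd n \<and> squarefree d}"
    show "d \<in> A \<union> (*) p ` A"
    proof (cases "p dvd d")
      case True
      then obtain e where e: "d = p * e" by (elim dvdE)
      have "\<not> p dvd e"
      proof
        assume "p dvd e"
        then have "p ^ 2 dvd d" by (simp add: e power2_eq_square)
        then have "p dvd 1" using d unfolding squarefree_def by blast
        then show False using p by auto
      qed
      moreover have "squarefree e" "e dvd n"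
        using d e by (auto dest: squarefree_multD dvd_mult_right)
      ultimately show ?thesis using e by (auto simp: A_def)
    qed (use d in \<open>auto simp: A_def\<close>)
  next
    fix d assume "d \<in> A \<union> (*) p ` A"
    then show "d \<in> {d. d dvd n \<and> squarefree d}"
    proof
      assume "d \<in> (*) p ` A"
      then obtain e where e: "d = p * e" "e dvd n" "squarefree e" "\<not> p dvd e"
        by (auto simp: A_def)
      have "coprime p e" using p e by (simp add: prime_imp_coprime)
      then show ?thesis
        using e p by (auto simp: squarefree_mult_coprime squarefree_prime divides_mult)
    qed (auto simp: A_def)
  qed
  have "(\<Sum>d | d dvd n. moebius_mu d) = (\<Sum>d | d dvd n \<and> squarefree d. moebius_mu d)"
    by (rule sum.mono_neutral_right) (use fin in \<open>auto simp: moebius_mu_def\<close>)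
  also have "\<dots> = (\<Sum>d\<in>A. moebius_mu d) + (\<Sum>d\<in>(*) p ` A. moebius_mu d)"
    unfolding split by (rule sum.union_disjoint) (use finA in \<open>auto simp: A_def\<close>)
  also have "(\<Sum>d\<in>(*) p ` A. moebius_mu d) = (\<Sum>d\<in>A. moebius_mu (p * d))"
    using p0 by (simp add: sum.reindex inj_on_def)
  also have "\<dots> = (\<Sum>d\<in>A. - moebius_mu d)"
    by (rule sum.cong) (auto simp: A_def moebius_mu_prime_mult p)
  finally show ?thesis using False by (simp add: sum_negf)
qed

text \<open>After insertion of \<open>f\<close>, both orders of summation run over the pairs with \<open>d * e\<close> dividing \<open>n\<close>;
  summing over \<open>d\<close> first leaves the single term \<open>e = n\<close>.\<close>

lemma moebius_inversion:
  fixes f g :: "nat \<Rightarrow> real"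
  assumes f: "\<And>n. n > 0 \<Longrightarrow> f n = (\<Sum>d | d dvd n. g d)" and n: "n > 0"
  shows "g n = (\<Sum>d | d dvd n. real_of_int (moebius_mu d) * f (n div d))"
proof -
  define D where "D = {d. d dvd n}"
  have fin: "finite D" using n by (simp add: D_def)
  have div: "{e. e dvd n div d} = {e \<in> D. d * e dvd n}" if "d dvd n" for d
    using that n by (auto simp: D_def elim!: dvdE)
  have "(\<Sum>d\<in>D. real_of_int (moebius_mu d) * f (n div d))
      = (\<Sum>d\<in>D. \<Sum>e | e \<in> D \<and> d * e dvd n. real_of_int (moebius_mu d) * g e)"
  proof (rule sum.cong[OF refl])
    fix d assume d: "d \<in> D"
    then have "n div d > 0" using n by (auto simp: D_def dvd_imp_le div_greater_zero_iff)
    then show "real_of_int (moebius_mu d) * f (n div d)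
        = (\<Sum>e | e \<in> D \<and> d * e dvd n. real_of_int (moebius_mu d) * g e)"
      using d div[of d] by (simp add: f sum_distrib_left D_def)
  qed
  also have "\<dots> = (\<Sum>e\<in>D. \<Sum>d | d \<in> D \<and> d * e dvd n. real_of_int (moebius_mu d) * g e)"
    by (rule sum.swap_restrict[OF fin fin])
  also have "\<dots> = (\<Sum>e\<in>D. if e = n then g e else 0)"
  proof (rule sum.cong[OF refl])
    fix e assume e: "e \<in> D"
    then have e0: "n div e > 0" using n by (auto simp: D_def dvd_imp_le div_greater_zero_iff)
    have "{d. d \<in> D \<and> d * e dvd n} = {d. d dvd n div e}"
      using div[of e] e by (simp add: D_def mult.commute)
    then have "(\<Sum>d | d \<in> D \<and> d * e dvd n. real_of_int (moebius_mu d) * g e)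
        = real_of_int (\<Sum>d | d dvd n div e. moebius_mu d) * g e"
      by (simp add: sum_distrib_right)
    also have "\<dots> = (if n div e = 1 then g e else 0)"
      using sum_moebius_mu_divisors[OF e0] by simp
    also have "n div e = 1 \<longleftrightarrow> e = n"
      using e n by (auto simp: D_def elim!: dvdE)
    finally show "(\<Sum>d | d \<in> D \<and> d * e dvd n. real_of_int (moebius_mu d) * g e)
        = (if e = n then g e else 0)" .
  qed
  also have "\<dots> = g n" using fin by (simp add: D_def)
  finally show ?thesis by (simp add: D_def)
qed

section \<open>Periodic sequences and their symmetries\<close>

lemma periodic_iff_translate: "periodic m u \<longleftrightarrow> translate (int m) u = u"
  by (simp add: periodic_def translate_def fun_eq_iff)

lemma periodic_add_mult:
  assumes "periodic n u"
  shows "u (i + int n * k) = u i"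
proof (induction k rule: int_induct[where k = 0])
  case (step1 k)
  have "u (i + int n * (k + 1)) = u (i + int n * k + int n)" by (simp add: algebra_simps)
  then show ?case using step1 assms by (simp add: periodic_def)
next
  case (step2 k)
  have "u (i + int n * (k - 1)) = u (i + int n * (k - 1) + int n)"
    using assms by (simp add: periodic_def)
  then show ?case using step2 by (simp add: algebra_simps)
qed auto

lemma periodic_mod: "periodic n u \<Longrightarrow> u (i mod int n) = u i"
  using periodic_add_mult[of n u "i mod int n" "i div int n"] by simp

lemma periodic_range_finite:
  assumes "periodic n u" "n > 0"
  shows "finite (range u)"
proof -
  have "u i \<in> u ` {0..<int n}" for i
    using periodic_mod[OF assms(1), of i] assms(2) by (intro image_eqI[of _ _ "i mod int n"]) auto
  then have "range u \<subseteq> u ` {0..<int n}" by blast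
  then show ?thesis by (rule finite_subset) simp
qed

lemma periodic_dvd: "periodic m u \<Longrightarrow> m dvd n \<Longrightarrow> periodic n u"
  unfolding periodic_def using periodic_add_mult by (auto elim!: dvdE simp: periodic_def)

lemma periodic_gcd:
  assumes m: "periodic m u" and n: "periodic n u"
  shows "periodic (gcd m n) u"
proof -
  obtain x y where "x * int m + y * int n = gcd (int m) (int n)"
    using bezout_int by blast
  then have "int (gcd m n) = int m * x + int n * y"
    by (simp add: mult.commute)
  then have "u (i + int (gcd m n)) = u (i + int m * x + int n * y)" for i
    by (simp add: add.assoc)
  then show ?thesis
    by (simp add: periodic_def periodic_add_mult[OF m] periodic_add_mult[OF n])
qed

lemma translate_mod: "periodic n u \<Longrightarrow> translate (l mod int n) u = translate l u"
proof
  fix i assume u: "periodic n u"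
  show "translate (l mod int n) u i = translate l u i"
    using periodic_add_mult[OF u, of "i + l mod int n" "l div int n"]
    by (simp add: translate_def add.assoc)
qed

lemma translate_reflect: "translate l (reflect u) = reflect (translate (- l) u)"
  by (simp add: translate_def reflect_def fun_eq_iff algebra_simps)

lemma inj_translate: "inj (translate l)"
  by (rule inj_on_inverseI[of _ "translate (- l)"]) (simp add: translate_translate translate_0)

lemma inj_reflect: "inj reflect"
  by (rule inj_on_inverseI[of _ reflect]) (simp add: reflect_reflect)

lemma periodic_translate [simp]: "periodic m (translate l u) \<longleftrightarrow> periodic m u"
  using inj_eq[OF inj_translate, of l "translate (int m) u" u]
  by (simp add: periodic_iff_translate translate_translate add.commute)

lemma periodic_reflect [simp]: "periodic m (reflect u) \<longleftrightarrow> periodic m u"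
proof -
  have "periodic m (reflect u)" if "periodic m u" for u
    unfolding periodic_def reflect_def
  proof
    fix i
    show "u (1 - (i + int m)) = u (1 - i)"
      using periodic_add_mult[OF that, of "1 - i" "-1"] by (simp add: algebra_simps)
  qed
  from this[of u] this[of "reflect u"] show ?thesis by (auto simp: reflect_reflect)
qed

lemma primitive_translate [simp]: "primitive m (translate l u) \<longleftrightarrow> primitive m u"
  by (simp add: primitive_def)

lemma primitive_reflect [simp]: "primitive m (reflect u) \<longleftrightarrow> primitive m u"
  by (simp add: primitive_def)

lemma primitive_unique:
  assumes "primitive m u" "primitive n u"
  shows "m = n"
proof (rule ccontr)
  assume "m \<noteq> n"
  then consider "m < n" | "n < m" by linarith
  then show False using assms by cases (auto simp: primitive_def)
qed

text \<open>The smallest period divides every period because the periods are closed under \<open>gcd\<close>.\<close>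

lemma primitive_exists:
  assumes "periodic n u" "n > 0"
  obtains m where "m dvd n" "primitive m u"
proof -
  define m where "m = (LEAST m. m > 0 \<and> periodic m u)"
  have m: "m > 0" "periodic m u"
    using LeastI[of "\<lambda>m. m > 0 \<and> periodic m u" n] assms by (auto simp: m_def)
  have least: "m \<le> k" if "k > 0" "periodic k u" for k
    unfolding m_def using that by (intro Least_le) auto
  have "gcd m n > 0" using m by simp
  then have "m \<le> gcd m n" using periodic_gcd[OF m(2) assms(1)] by (rule least)
  then have "m dvd n" using m(1)
    by (metis gcd_dvd2 gcd_le1_nat le_antisym less_irrefl_nat)
  moreover have "primitive m u"
    unfolding primitive_def
  proof (intro conjI allI impI notI m)
    fix k assume "0 < k \<and> k < m" "periodic k u"
    then show False using least[of k] by simp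
  qed
  ultimately show ?thesis by (rule that)
qed

section \<open>Periodic words and palindromes\<close>

definition words :: "real set \<Rightarrow> nat \<Rightarrow> (int \<Rightarrow> real) set" where
  "words A n = {w. periodic n w \<and> range w \<subseteq> A}"

definition primitive_words :: "real set \<Rightarrow> nat \<Rightarrow> (int \<Rightarrow> real) set" where
  "primitive_words A n = {w \<in> words A n. primitive n w}"

lemma words_periodic: "w \<in> words A n \<Longrightarrow> periodic n w"
  by (simp add: words_def)

lemma range_translate [simp]: "range (translate l w) = range w"
  by (auto simp: translate_def image_iff) (metis diff_add_cancel)

lemma range_reflect [simp]: "range (reflect w) = range w"
  by (auto simp: reflect_def image_iff) (metis diff_diff_eq2 add_diff_cancel_left' diff_add_cancel)

lemma words_translate [simp]: "translate l w \<in> words A n \<longleftrightarrow> w \<in> words A n"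
  by (simp add: words_def)

lemma words_reflect [simp]: "reflect w \<in> words A n \<longleftrightarrow> w \<in> words A n"
  by (simp add: words_def)

text \<open>A function that is invariant under a retraction \<open>r\<close> onto \<open>J\<close> is determined by its values on \<open>J\<close>,
  which are arbitrary. Periodicity and palindromic symmetry are both of this kind.\<close>

lemma words_retract:
  fixes r :: "int \<Rightarrow> int"
  assumes A: "finite A" and J: "finite J" "\<And>i. r i \<in> J" "\<And>j. j \<in> J \<Longrightarrow> r j = j"
  shows "finite {u :: int \<Rightarrow> real. range u \<subseteq> A \<and> u \<circ> r = u}"
    and "card {u :: int \<Rightarrow> real. range u \<subseteq> A \<and> u \<circ> r = u} = card A ^ card J"
proof -
  let ?W = "{u :: int \<Rightarrow> real. range u \<subseteq> A \<and> u \<circ> r = u}"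
  have bij: "bij_betw (\<lambda>u. restrict u J) ?W (J \<rightarrow>\<^sub>E A)"
  proof (rule bij_betw_byWitness[where f' = "\<lambda>f. f \<circ> r"])
    show "\<forall>u\<in>?W. restrict u J \<circ> r = u"
      using J by (auto simp: fun_eq_iff)
    show "\<forall>f\<in>J \<rightarrow>\<^sub>E A. restrict (f \<circ> r) J = f"
      using J by (auto simp: fun_eq_iff PiE_def extensional_def restrict_def)
    show "(\<lambda>u. restrict u J) ` ?W \<subseteq> J \<rightarrow>\<^sub>E A" by auto
    show "(\<lambda>f. f \<circ> r) ` (J \<rightarrow>\<^sub>E A) \<subseteq> ?W"
      using J by (auto simp: fun_eq_iff)
  qed
  show "finite ?W"
    using bij_betw_finite[OF bij] A J by (simp add: finite_PiE)
  show "card ?W = card A ^ card J"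
    using bij_betw_same_card[OF bij] J by (simp add: card_PiE)
qed

lemma words_finite_card:
  assumes A: "finite A" and n: "n > 0"
  shows "finite (words A n)" "card (words A n) = card A ^ n"
proof -
  have "words A n = {u. range u \<subseteq> A \<and> u \<circ> (\<lambda>i. i mod int n) = u}"
    by (auto simp: words_def periodic_mod fun_eq_iff) (metis mod_add_self2 periodic_def)
  then show "finite (words A n)" "card (words A n) = card A ^ n"
    using words_retract[OF A, of "{0..<int n}" "\<lambda>i. i mod int n"] n by auto
qed

text \<open>The words that are symmetric about \<open>c / 2\<close>, that is, the fixed points of a reflection.\<close>

definition palindromes :: "real set \<Rightarrow> nat \<Rightarrow> int \<Rightarrow> (int \<Rightarrow> real) set" where
  "palindromes A n c = {u \<in> words A n. \<forall>i. u (c - i) = u i}"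

text \<open>A translation by \<open>t\<close> moves the centre of symmetry from \<open>c / 2\<close> to \<open>c / 2 - t\<close>. Together with the
  periodicity in \<open>c\<close> modulo \<open>n\<close>, this leaves \<open>c = 0\<close> and, for even \<open>n\<close> only, \<open>c = - 1\<close>.\<close>

lemma card_palindromes_shift: "card (palindromes A n c) = card (palindromes A n (c - 2 * t))"
proof (rule bij_betw_same_card[of "translate t"], rule bij_betw_byWitness[where f' = "translate (- t)"])
  have 1: "translate s u \<in> palindromes A n (c - 2 * s)" if "u \<in> palindromes A n c" for u c s
  proof -
    have "u (c - 2 * s - i + s) = u (i + s)" for i
      using that[unfolded palindromes_def, simplified, THEN conjunct2, rule_format, of "i + s"]
      by (simp add: algebra_simps)
    then show ?thesis using that by (simp add: palindromes_def) (simp add: translate_def)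
  qed
  show "translate t ` palindromes A n c \<subseteq> palindromes A n (c - 2 * t)" using 1 by blast
  show "translate (- t) ` palindromes A n (c - 2 * t) \<subseteq> palindromes A n c"
    using 1[of _ "c - 2 * t" "- t"] by auto
qed (auto simp: translate_translate translate_0)

lemma palindromes_mod: "palindromes A n (c + int n * k) = palindromes A n c"
proof -
  have "(\<forall>i. u (c + int n * k - i) = u i) \<longleftrightarrow> (\<forall>i. u (c - i) = u i)"
    if "u \<in> words A n" for u
  proof -
    have "u (c + int n * k - i) = u (c - i)" for i
      using periodic_add_mult[OF words_periodic[OF that], of "c - i" k] by (simp add: algebra_simps)
    then show ?thesis by (simp only:)
  qed
  then show ?thesis unfolding palindromes_def by blast
qed

text \<open>Folding one period about \<open>0\<close> leaves the free positions \<open>0, ..., n div 2\<close>: position \<open>0\<close> is its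
  own mirror image, and so is \<open>n div 2\<close> if \<open>n\<close> is even.\<close>

lemma card_palindromes_0:
  assumes A: "finite A" and n: "n > 0"
  shows "card (palindromes A n 0) = card A ^ (n div 2 + 1)"
proof -
  define r where "r i = min (i mod int n) (int n - i mod int n)" for i
  have mod: "0 \<le> i mod int n" "i mod int n < int n" for i using n by auto
  have "palindromes A n 0 = {u. range u \<subseteq> A \<and> u \<circ> r = u}"
  proof (intro Set.set_eqI iffI)
    fix u assume u: "u \<in> palindromes A n 0"
    then have per: "periodic n u" and sym: "\<And>i. u (- i) = u i" by (auto simp: palindromes_def words_def)
    have "u (r i) = u i" for i
      using periodic_mod[OF per, of i] periodic_add_mult[OF per, of "- (i mod int n)" 1] sym[of "i mod int n"]
      by (auto simp: r_def min_def)
    then show "u \<in> {u. range u \<subseteq> A \<and> u \<circ> r = u}"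
      using u by (auto simp: palindromes_def words_def fun_eq_iff)
  next
    fix u assume u: "u \<in> {u. range u \<subseteq> A \<and> u \<circ> r = u}"
    then have ur: "u i = u (r i)" for i by (auto simp: fun_eq_iff)
    have "r (i + int n) = r i" for i by (simp add: r_def)
    moreover have "r (- i) = r i" for i
      using mod[of i] by (auto simp: r_def zmod_zminus1_eq_if min_def)
    ultimately have "u (i + int n) = u i" "u (- i) = u i" for i by (metis ur)+
    then show "u \<in> palindromes A n 0" using u by (auto simp: palindromes_def words_def periodic_def)
  qed
  moreover have "card {0..int (n div 2)} = n div 2 + 1" by simp
  moreover have "r i \<in> {0..int (n div 2)}" for i using mod[of i] by (auto simp: r_def min_def)
  moreover have "r j = j" if "j \<in> {0..int (n div 2)}" for j
  proof -
    have "j < int n" "j \<le> int n - j" using that n by auto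
    then show ?thesis using that by (simp add: r_def)
  qed
  ultimately show ?thesis using words_retract(2)[OF A, of "{0..int (n div 2)}" r] by simp
qed

text \<open>The axis lies halfway between two positions, and so does the opposite one because \<open>n\<close> is even:
  no position is its own mirror image.\<close>

lemma card_palindromes_minus_1:
  assumes A: "finite A" and n: "n > 0" "even n"
  shows "card (palindromes A n (- 1)) = card A ^ (n div 2)"
proof -
  define r where "r i = min (i mod int n) (int n - 1 - i mod int n)" for i
  have mod: "0 \<le> i mod int n" "i mod int n < int n" for i using n by auto
  have "palindromes A n (- 1) = {u. range u \<subseteq> A \<and> u \<circ> r = u}"
  proof (intro Set.set_eqI iffI)
    fix u assume u: "u \<in> palindromes A n (- 1)"
    then have per: "periodic n u" and sym: "\<And>i. u (- 1 - i) = u i" by (auto simp: palindromes_def words_def)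
    have "u (int n - 1 - i mod int n) = u i" for i
      using periodic_mod[OF per, of i] periodic_add_mult[OF per, of "- 1 - (i mod int n)" 1] sym[of "i mod int n"]
      by (simp add: algebra_simps)
    then have "u (r i) = u i" for i
      using periodic_mod[OF per, of i] by (auto simp: r_def min_def)
    then show "u \<in> {u. range u \<subseteq> A \<and> u \<circ> r = u}"
      using u by (auto simp: palindromes_def words_def fun_eq_iff)
  next
    fix u assume u: "u \<in> {u. range u \<subseteq> A \<and> u \<circ> r = u}"
    then have ur: "u i = u (r i)" for i by (auto simp: fun_eq_iff)
    have "r (i + int n) = r i" for i by (simp add: r_def)
    moreover have "(- 1 - i) mod int n = int n - 1 - i mod int n" for i
    proof -
      have "(- 1 - i) mod int n = (int n - 1 - i mod int n) mod int n"
        using mod_add_self1[of "int n" "- 1 - i mod int n"] mod_diff_right_eq[of "- 1" i "int n"]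
        by (simp add: algebra_simps)
      also have "\<dots> = int n - 1 - i mod int n"
        using mod[of i] by (intro mod_pos_pos_trivial) auto
      finally show ?thesis .
    qed
    then have "r (- 1 - i) = r i" for i by (simp add: r_def min.commute)
    ultimately have "u (i + int n) = u i" "u (- 1 - i) = u i" for i by (metis ur)+
    then show "u \<in> palindromes A n (- 1)" using u by (auto simp: palindromes_def words_def periodic_def)
  qed
  moreover have "card {0..<int (n div 2)} = n div 2" by simp
  moreover have "r i \<in> {0..<int (n div 2)}" for i
    using mod[of i] n by (auto simp: r_def min_def elim!: evenE)
  moreover have "r j = j" if "j \<in> {0..<int (n div 2)}" for j
  proof -
    have "j < int n" "j \<le> int n - 1 - j" using that n by auto
    then show ?thesis using that by (simp add: r_def)
  qed
  ultimately show ?thesis using words_retract(2)[OF A, of "{0..<int (n div 2)}" r] by simp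
qed

lemma card_palindromes:
  assumes A: "finite A" and n: "n > 0"
  shows "card (palindromes A n c) = card A ^ (if odd n then (n + 1) div 2 else if even c then n div 2 + 1 else n div 2)"
proof (cases "even c")
  case True
  then have "card (palindromes A n c) = card (palindromes A n 0)"
    using card_palindromes_shift[of A n c "c div 2"] by simp
  then show ?thesis using card_palindromes_0[OF A n] True by auto
next
  case c: False
  show ?thesis
  proof (cases "even n")
    case True
    obtain k where "c = 2 * k + 1" using c by (elim oddE)
    then have "card (palindromes A n c) = card (palindromes A n (- 1))"
      using card_palindromes_shift[of A n c "k + 1"] by simp
    then show ?thesis using card_palindromes_minus_1[OF A n True] c True by simp
  next
    case False
    have "card (palindromes A n c) = card (palindromes A n (c + int n * 1))"
      by (simp only: palindromes_mod)
    also have "\<dots> = card (palindromes A n 0)"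
      using card_palindromes_shift[of A n "c + int n * 1" "(c + int n) div 2"] c False by simp
    finally show ?thesis using card_palindromes_0[OF A n] False by auto
  qed
qed

section \<open>Orbits under translations and reflections\<close>

definition translation_orbit :: "(int \<Rightarrow> real) \<Rightarrow> (int \<Rightarrow> real) set" where
  "translation_orbit u = range (\<lambda>l. translate l u)"

text \<open>A reflection after a translation already exhausts the group, since the reflection conjugates
  each translation into its inverse.\<close>

definition dihedral_orbit :: "(int \<Rightarrow> real) \<Rightarrow> (int \<Rightarrow> real) set" where
  "dihedral_orbit u = translation_orbit u \<union> reflect ` translation_orbit u"

lemma trans_refl_equiv_iff: "trans_refl_equiv u v \<longleftrightarrow> v \<in> dihedral_orbit u"
proof
  assume "trans_refl_equiv u v"
  then show "v \<in> dihedral_orbit u"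
  proof induction
    case base
    then show ?case
      by (auto simp: dihedral_orbit_def translation_orbit_def intro: range_eqI[of _ _ 0] simp: translate_0)
  next
    case (translate v l)
    then show ?case
      by (auto simp: dihedral_orbit_def translation_orbit_def translate_translate translate_reflect)
  next
    case (reflect v)
    then show ?case
      by (auto simp: dihedral_orbit_def translation_orbit_def reflect_reflect)
  qed
next
  assume "v \<in> dihedral_orbit u"
  then show "trans_refl_equiv u v"
    by (auto simp: dihedral_orbit_def translation_orbit_def intro: trans_refl_equiv.intros)
qed

lemma translation_orbit_periodic:
  assumes "periodic n u" "n > 0"
  shows "translation_orbit u = (\<lambda>l. translate l u) ` {0..<int n}"
proof -
  have "translate l u \<in> (\<lambda>l. translate l u) ` {0..<int n}" for l
    using translate_mod[OF assms(1), of l] assms(2)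
    by (intro image_eqI[of _ _ "l mod int n"]) auto
  then show ?thesis by (auto simp: translation_orbit_def)
qed

text \<open>The dihedral group is encoded by pairs of a reflection flag and a translation length. Distinct
  pairs may act as the same map, for instance on words of period 2, so the maps themselves would be
  too few for Burnside's count with \<open>2 * n\<close> indices.\<close>

definition dihedral_action :: "bool \<times> int \<Rightarrow> (int \<Rightarrow> real) \<Rightarrow> int \<Rightarrow> real" where
  "dihedral_action g u = (if fst g then reflect (translate (snd g) u) else translate (snd g) u)"

lemma dihedral_orbit_periodic:
  assumes "periodic n u" "n > 0"
  shows "dihedral_orbit u = (\<lambda>g. dihedral_action g u) ` (UNIV \<times> {0..<int n})"
proof -
  have "(UNIV :: bool set) \<times> {0..<int n} = Pair False ` {0..<int n} \<union> Pair True ` {0..<int n}"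
    by (auto simp: UNIV_bool)
  then show ?thesis
    unfolding dihedral_orbit_def translation_orbit_periodic[OF assms]
    by (simp only: image_Un image_image) (simp add: dihedral_action_def)
qed

lemma bij_betw_add_mod:
  assumes "n > 0"
  shows "bij_betw (\<lambda>i. (i + j) mod int n) {0..<int n} {0..<int n}"
  by (rule bij_betw_byWitness[where f' = "\<lambda>i. (i - j) mod int n"])
     (use assms in \<open>auto simp: mod_simps\<close>)

lemma card_translation_orbits:
  assumes S: "finite S" "\<And>u. u \<in> S \<Longrightarrow> periodic n u" and n: "n > 0"
    and closed: "\<And>l u. u \<in> S \<Longrightarrow> translate l u \<in> S"
  shows "card (translation_orbit ` S) * n = (\<Sum>l\<in>{0..<int n}. card {u \<in> S. translate l u = u})"
proof -
  have "translation_orbit ` S = (\<lambda>u. (\<lambda>l. translate l u) ` {0..<int n}) ` S"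
    using translation_orbit_periodic S(2) n by (intro image_cong) auto
  moreover have "card ((\<lambda>u. (\<lambda>l. translate l u) ` {0..<int n}) ` S) * card {0..<int n}
      = (\<Sum>l\<in>{0..<int n}. card {u \<in> S. translate l u = u})"
  proof (rule orbit_count[where e = 0])
    fix j assume "j \<in> {0..<int n}"
    have "translate ((i + j) mod int n) u = translate j (translate i u)" if "u \<in> S" for i u
      using translate_mod[OF S(2)[OF that]] by (simp add: translate_translate add.commute)
    then show "\<exists>\<psi>. bij_betw \<psi> {0..<int n} {0..<int n} \<and>
        (\<forall>i\<in>{0..<int n}. \<forall>u\<in>S. translate (\<psi> i) u = translate j (translate i u))"
      using bij_betw_add_mod[OF n, of j] by blast
  qed (use S n closed inj_on_subset[OF inj_translate] in \<open>auto simp: translate_0\<close>)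
  ultimately show ?thesis by simp
qed

text \<open>The pairs \<open>(b, l)\<close> are multiplied as in the dihedral group: a translation that is moved past a
  reflection changes its sign, so left multiplication subtracts lengths on reflections.\<close>

lemma card_dihedral_orbits:
  assumes S: "finite S" "\<And>u. u \<in> S \<Longrightarrow> periodic n u" and n: "n > 0"
    and closed: "\<And>l u. u \<in> S \<Longrightarrow> translate l u \<in> S" "\<And>u. u \<in> S \<Longrightarrow> reflect u \<in> S"
  shows "card (dihedral_orbit ` S) * (2 * n) = (\<Sum>l\<in>{0..<int n}. card {u \<in> S. translate l u = u})
    + (\<Sum>l\<in>{0..<int n}. card {u \<in> S. reflect (translate l u) = u})"
proof -
  define I where "I = (UNIV :: bool set) \<times> {0..<int n}"
  have cardI: "card I = 2 * n" by (simp add: I_def card_cartesian_product)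
  have "dihedral_orbit ` S = (\<lambda>u. (\<lambda>g. dihedral_action g u) ` I) ` S"
    unfolding I_def using dihedral_orbit_periodic S(2) n by (intro image_cong) auto
  moreover have "card ((\<lambda>u. (\<lambda>g. dihedral_action g u) ` I) ` S) * card I
      = (\<Sum>g\<in>I. card {u \<in> S. dihedral_action g u = u})"
  proof (rule orbit_count[where e = "(False, 0)"])
    fix j assume "j \<in> I"
    obtain b' m where j: "j = (b', m)" by (cases j)
    \<comment> \<open>Left multiplication by \<open>j\<close> and its inverse.\<close>
    define \<psi> where "\<psi> g = (b' \<noteq> fst g, (if fst g then snd g - m else snd g + m) mod int n)" for g
    define \<psi>' where "\<psi>' g = (b' \<noteq> fst g, (if b' \<noteq> fst g then snd g + m else snd g - m) mod int n)" for g
    have "bij_betw \<psi> I I"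
      by (rule bij_betw_byWitness[where f' = \<psi>'])
         (use n in \<open>auto simp: I_def \<psi>_def \<psi>'_def mod_simps split: if_splits\<close>)
    moreover have "dihedral_action (\<psi> g) u = dihedral_action j (dihedral_action g u)" if "u \<in> S" for g u
      using translate_mod[OF S(2)[OF that]]
      by (auto simp: dihedral_action_def \<psi>_def j translate_translate translate_reflect
            reflect_reflect add.commute)
    ultimately show "\<exists>\<psi>. bij_betw \<psi> I I \<and>
        (\<forall>g\<in>I. \<forall>u\<in>S. dihedral_action (\<psi> g) u = dihedral_action j (dihedral_action g u))"
      by blast
  next
    fix g
    have "inj (dihedral_action g)"
    proof (cases "fst g")
      case True
      then have "dihedral_action g = reflect \<circ> translate (snd g)"
        by (intro ext) (simp add: dihedral_action_def)
      then show ?thesis using inj_compose[OF inj_reflect inj_translate] by simp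
    next
      case False
      then have "dihedral_action g = translate (snd g)"
        by (intro ext) (simp add: dihedral_action_def)
      then show ?thesis using inj_translate by simp
    qed
    then show "inj_on (dihedral_action g) S" by (rule inj_on_subset) auto
  qed (use S n closed in \<open>auto simp: I_def dihedral_action_def translate_0\<close>)
  moreover have "(\<Sum>g\<in>I. card {u \<in> S. dihedral_action g u = u})
      = (\<Sum>b\<in>UNIV. \<Sum>l\<in>{0..<int n}. card {u \<in> S. dihedral_action (b, l) u = u})"
    unfolding I_def by (simp add: sum.cartesian_product)
  ultimately show ?thesis
    by (simp add: cardI UNIV_bool dihedral_action_def)
qed

section \<open>Counting words up to symmetry\<close>

text \<open>A word of period \<open>n\<close> is fixed by the translation by \<open>l\<close> if and only if it has period
  \<open>gcd l n\<close>, and a divisor \<open>d\<close> of \<open>n\<close> is this \<open>gcd\<close> for \<open>totient (n div d)\<close> residues \<open>l\<close>.\<close>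

lemma sum_card_translation_fixed_words:
  assumes A: "finite A" and n: "n > 0"
  shows "real (\<Sum>l\<in>{0..<int n}. card {u \<in> words A n. translate l u = u}) = real n * necklaces (card A) n"
proof -
  have fixed: "{u \<in> words A n. translate (int l) u = u} = words A (gcd l n)" for l
  proof -
    have "periodic n u \<and> periodic l u \<longleftrightarrow> periodic (gcd l n) u" for u
      using periodic_gcd[of l u n] periodic_dvd[of "gcd l n" u n] periodic_dvd[of "gcd l n" u l] by auto
    then show ?thesis by (auto simp: words_def periodic_iff_translate[symmetric])
  qed
  \<comment> \<open>The totient counts residues among \<open>1, ..., n\<close>, so the trivial translation by \<open>0\<close> is renamed to \<open>n\<close>.\<close>
  have "(\<Sum>l\<in>{0..<int n}. card {u \<in> words A n. translate l u = u})
      = (\<Sum>l\<in>{0<..n}. card {u \<in> words A n. translate (int l) u = u})"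
  proof (rule sum.reindex_bij_witness[where i = "\<lambda>l. if l = n then 0 else int l" and j = "\<lambda>l. if l = 0 then n else nat l"])
    fix l assume l: "l \<in> {0..<int n}"
    have "{u \<in> words A n. translate (int n) u = u} = {u \<in> words A n. translate 0 u = u}"
      by (auto simp: words_def periodic_iff_translate translate_0)
    then show "card {u \<in> words A n. translate (int (if l = 0 then n else nat l)) u = u}
        = card {u \<in> words A n. translate l u = u}"
      using l by auto
  qed (use n in \<open>auto simp: nat_eq_iff split: if_splits\<close>)
  also have "\<dots> = (\<Sum>l\<in>{0<..n}. card A ^ gcd l n)"
    unfolding fixed using n by (intro sum.cong refl words_finite_card(2)[OF A]) auto
  also have "\<dots> = (\<Sum>d | d dvd n. \<Sum>l | l \<in> {0<..n} \<and> gcd l n = d. card A ^ gcd l n)"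
    by (rule sum.group[symmetric]) (use n in auto)
  also have "\<dots> = (\<Sum>d | d dvd n. totient (n div d) * card A ^ d)"
    by (rule sum.cong) (use card_gcd_eq_totient n in auto)
  also have "\<dots> = (\<Sum>m | m dvd n. totient m * card A ^ (n div m))"
    by (rule sum.reindex_bij_witness[where i = "\<lambda>d. n div d" and j = "\<lambda>d. n div d"])
       (use n in \<open>auto elim!: dvdE\<close>)
  finally show ?thesis using n by (simp add: necklaces_def)
qed

lemma card_word_necklaces:
  assumes A: "finite A" and n: "n > 0"
  shows "real (card (translation_orbit ` words A n)) = necklaces (card A) n"
proof -
  have "card (translation_orbit ` words A n) * n
      = (\<Sum>l\<in>{0..<int n}. card {u \<in> words A n. translate l u = u})"
    using words_finite_card(1)[OF A n] n
    by (intro card_translation_orbits) (simp_all add: words_periodic)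
  then have "real (card (translation_orbit ` words A n)) * real n = real n * necklaces (card A) n"
    using sum_card_translation_fixed_words[OF A n] by (simp flip: of_nat_mult)
  then show ?thesis using n by simp
qed

text \<open>For even \<open>n\<close> the \<open>n\<close> axes alternate between those through two positions and those through none;
  for odd \<open>n\<close> every axis passes through exactly one position.\<close>

lemma sum_card_reflection_fixed_words:
  assumes A: "finite A" and n: "n > 0"
  shows "real (\<Sum>l\<in>{0..<int n}. card {u \<in> words A n. reflect (translate l u) = u})
    = real n * (if even n then (real (card A) + 1) / 2 * real (card A) ^ (n div 2)
        else real (card A) ^ ((n + 1) div 2))"
proof -
  let ?k = "card A"
  have "{u \<in> words A n. reflect (translate l u) = u} = palindromes A n (l + 1)" for l
    by (auto simp: palindromes_def reflect_def translate_def fun_eq_iff algebra_simps)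
  then have eq: "(\<Sum>l\<in>{0..<int n}. card {u \<in> words A n. reflect (translate l u) = u})
      = (\<Sum>l\<in>{0..<int n}. card (palindromes A n (l + 1)))" by simp
  show ?thesis
  proof (cases "even n")
    case False
    then show ?thesis unfolding eq by (simp add: card_palindromes[OF A n])
  next
    case True
    then obtain h where h: "n = 2 * h" by (elim evenE)
    have "(\<Sum>l\<in>{0..<int (2 * h)}. f (odd l)) = h * f True + h * f False" for f :: "bool \<Rightarrow> nat"
    proof (induction h)
      case (Suc h)
      have "{0..<int (2 * Suc h)} = insert (2 * int h) (insert (2 * int h + 1) {0..<int (2 * h)})"
        by auto
      then show ?case using Suc by simp
    qed simp
    note parity_sum = this[of "\<lambda>b. if b then ?k ^ (h + 1) else ?k ^ h"]
    have "card (palindromes A n (l + 1)) = (if odd l then ?k ^ (h + 1) else ?k ^ h)" for l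
      using card_palindromes[OF A n, of "l + 1"] h by simp
    then have "(\<Sum>l\<in>{0..<int n}. card (palindromes A n (l + 1))) = h * ?k ^ (h + 1) + h * ?k ^ h"
      using parity_sum by (simp add: h)
    then show ?thesis unfolding eq using True by (simp add: h field_simps)
  qed
qed

lemma card_word_bracelets:
  assumes A: "finite A" and n: "n > 0"
  shows "real (card (dihedral_orbit ` words A n)) = bracelets (card A) n"
proof -
  have count: "card (dihedral_orbit ` words A n) * (2 * n)
      = (\<Sum>l\<in>{0..<int n}. card {u \<in> words A n. translate l u = u})
      + (\<Sum>l\<in>{0..<int n}. card {u \<in> words A n. reflect (translate l u) = u})"
    using words_finite_card(1)[OF A n] n
    by (intro card_dihedral_orbits) (simp_all add: words_periodic)
  have "real (card (dihedral_orbit ` words A n)) * (2 * real n) =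
      real (\<Sum>l\<in>{0..<int n}. card {u \<in> words A n. translate l u = u})
      + real (\<Sum>l\<in>{0..<int n}. card {u \<in> words A n. reflect (translate l u) = u})"
    by (simp only: of_nat_add[symmetric] count[symmetric] of_nat_mult of_nat_numeral)
  then have "real (card (dihedral_orbit ` words A n)) * (2 * real n) = bracelets (card A) n * (2 * real n)"
    unfolding sum_card_translation_fixed_words[OF A n] sum_card_reflection_fixed_words[OF A n]
    by (simp add: bracelets_def algebra_simps)
  then show ?thesis using n by simp
qed

lemma words_eq_Union_primitive:
  assumes "n > 0"
  shows "words A n = (\<Union>m\<in>{m. m dvd n}. primitive_words A m)"
proof (intro Set.set_eqI iffI)
  fix w assume w: "w \<in> words A n"
  then obtain m where "m dvd n" "primitive m w"
    using primitive_exists assms unfolding words_def by blast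
  then show "w \<in> (\<Union>m\<in>{m. m dvd n}. primitive_words A m)"
    using w by (auto simp: primitive_words_def words_def primitive_def)
next
  fix w assume "w \<in> (\<Union>m\<in>{m. m dvd n}. primitive_words A m)"
  then show "w \<in> words A n"
    using periodic_dvd by (auto simp: primitive_words_def words_def)
qed

lemma card_primitive_words:
  assumes A: "finite A" and n: "n > 0"
  shows "real (card (primitive_words A n)) = real n * lyndon_words (card A) n"
proof -
  have "real (card A ^ n) = (\<Sum>m | m dvd n. real (card (primitive_words A m)))" if n: "n > 0" for n
  proof -
    have "card (words A n) = (\<Sum>m | m dvd n. card (primitive_words A m))"
      unfolding words_eq_Union_primitive[OF n]
    proof (rule card_UN_disjoint)
      show "\<forall>m\<in>{m. m dvd n}. finite (primitive_words A m)"
        using n words_finite_card(1)[OF A] by (auto simp: primitive_words_def dvd_pos_nat)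
      show "\<forall>i\<in>{m. m dvd n}. \<forall>j\<in>{m. m dvd n}. i \<noteq> j \<longrightarrow> primitive_words A i \<inter> primitive_words A j = {}"
        using primitive_unique by (auto simp: primitive_words_def)
    qed (use n in simp)
    then show ?thesis using words_finite_card(2)[OF A n] by (simp flip: of_nat_sum)
  qed
  from moebius_inversion[where f = "\<lambda>n. real (card A ^ n)", OF this n] show ?thesis
    using n by (simp add: lyndon_words_def)
qed

text \<open>A primitive word is fixed by none of the translations by \<open>1, ..., n - 1\<close>, so each of its orbits has
  \<open>n\<close> elements.\<close>

lemma card_word_lyndon:
  assumes A: "finite A" and n: "n > 0"
  shows "real (card (translation_orbit ` primitive_words A n)) = lyndon_words (card A) n"
proof -
  have fin: "finite (primitive_words A n)"
    using words_finite_card(1)[OF A n] by (simp add: primitive_words_def)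
  have "card (translation_orbit ` primitive_words A n) * n
      = (\<Sum>l\<in>{0..<int n}. card {u \<in> primitive_words A n. translate l u = u})"
    using fin n
    by (intro card_translation_orbits) (auto simp: primitive_words_def primitive_def[of n])
  also have "\<dots> = (\<Sum>l\<in>{0..<int n}. if l = 0 then card (primitive_words A n) else 0)"
  proof (rule sum.cong[OF refl])
    fix l assume l: "l \<in> {0..<int n}"
    have "translate l u \<noteq> u" if "l \<noteq> 0" "primitive n u" for u
      using that l periodic_iff_translate[of "nat l" u] by (auto simp: primitive_def)
    then have "{u \<in> primitive_words A n. translate l u = u} = (if l = 0 then primitive_words A n else {})"
      by (auto simp: primitive_words_def translate_0)
    then show "card {u \<in> primitive_words A n. translate l u = u}
        = (if l = 0 then card (primitive_words A n) else 0)"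
      by simp
  qed
  also have "\<dots> = card (primitive_words A n)" using n by simp
  finally have "real (card (translation_orbit ` primitive_words A n)) * real n = real n * lyndon_words (card A) n"
    using card_primitive_words[OF A n] by (simp flip: of_nat_mult)
  then show ?thesis using n by simp
qed

text \<open>The stabilizers of primitive words may contain reflections, so their orbits differ in size. But
  the smallest period is constant on every orbit, hence the bracelets of length \<open>n\<close> split into the
  primitive bracelets whose lengths divide \<open>n\<close>, and Moebius inversion applies.\<close>

lemma card_word_lyndon_bracelets:
  assumes A: "finite A" and n: "n > 0"
  shows "real (card (dihedral_orbit ` primitive_words A n)) = lyndon_bracelets (card A) n"
proof -
  have "bracelets (card A) n = (\<Sum>m | m dvd n. real (card (dihedral_orbit ` primitive_words A m)))"
    if n: "n > 0" for n
  proof -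
    have prim: "primitive m v" if "v \<in> dihedral_orbit u" "primitive m u" for u v m
      using that by (auto simp: dihedral_orbit_def translation_orbit_def)
    have self: "u \<in> dihedral_orbit u" for u
      using trans_refl_equiv.base[of u] by (simp add: trans_refl_equiv_iff)
    have "card (dihedral_orbit ` words A n) = (\<Sum>m | m dvd n. card (dihedral_orbit ` primitive_words A m))"
      unfolding words_eq_Union_primitive[OF n] image_UN
    proof (rule card_UN_disjoint)
      show "\<forall>m\<in>{m. m dvd n}. finite (dihedral_orbit ` primitive_words A m)"
        using n words_finite_card(1)[OF A] by (auto simp: primitive_words_def dvd_pos_nat)
      have "i = j" if C: "C \<in> dihedral_orbit ` primitive_words A i" "C \<in> dihedral_orbit ` primitive_words A j" for C i j
      proof -
        obtain u v where "primitive i u" "primitive j v" "C = dihedral_orbit u" "C = dihedral_orbit v"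
          using C unfolding primitive_words_def by blast
        then have "primitive i u" "primitive j u" using prim self by blast+
        then show ?thesis by (rule primitive_unique)
      qed
      then show "\<forall>i\<in>{m. m dvd n}. \<forall>j\<in>{m. m dvd n}. i \<noteq> j \<longrightarrow>
          dihedral_orbit ` primitive_words A i \<inter> dihedral_orbit ` primitive_words A j = {}"
        by blast
    qed (use n in simp)
    then show ?thesis using card_word_bracelets[OF A n] by (simp flip: of_nat_sum)
  qed
  from moebius_inversion[where f = "bracelets (card A)", OF this n] show ?thesis
    by (simp add: lyndon_bracelets_def)
qed

section \<open>Transport of the class counts\<close>

text \<open>An injective map that commutes with translations and with the reflection carries orbits to orbits,
  and it preserves the smallest period, because \<open>m\<close> is a period of \<open>u\<close> exactly if the translation
  by \<open>m\<close> fixes \<open>u\<close>.\<close>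

lemma class_counts:
  assumes A: "finite A" and n: "n > 0"
    and inj: "inj_on f (words A n)"
    and tr: "\<And>l w. w \<in> words A n \<Longrightarrow> f (translate l w) = translate l (f w)"
    and re: "\<And>w. w \<in> words A n \<Longrightarrow> f (reflect w) = reflect (f w)"
    and S: "S = f ` words A n"
  shows "card S = card A ^ n"
    and "real (card (S // trans_rel S)) = necklaces (card A) n"
    and "real (card (primitive_classes n (S // trans_rel S))) = lyndon_words (card A) n"
    and "real (card (S // trans_refl_rel S)) = bracelets (card A) n"
    and "real (card (primitive_classes n (S // trans_refl_rel S))) = lyndon_bracelets (card A) n"
proof -
  show "card S = card A ^ n"
    unfolding S using words_finite_card(2)[OF A n] by (simp add: card_image[OF inj])
  have closed: "translate l u \<in> S" "reflect u \<in> S" if u: "u \<in> S" for l u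
  proof -
    obtain w where w: "w \<in> words A n" "u = f w" using u unfolding S by blast
    show "translate l u \<in> S" unfolding S w(2) tr[OF w(1), symmetric] using w(1) by (intro imageI) simp
    show "reflect u \<in> S" unfolding S w(2) re[OF w(1), symmetric] using w(1) by (intro imageI) simp
  qed
  have orbS: "translation_orbit u \<subseteq> S" "dihedral_orbit u \<subseteq> S" if "u \<in> S" for u
    using closed that by (auto simp: dihedral_orbit_def translation_orbit_def)
  have quot: "S // trans_rel S = translation_orbit ` S" "S // trans_refl_rel S = dihedral_orbit ` S"
  proof -
    have "trans_rel S `` {u} = translation_orbit u" if "u \<in> S" for u
      using orbS[OF that] that by (auto simp: trans_rel_def translation_orbit_def)
    then show "S // trans_rel S = translation_orbit ` S"
      by (auto simp: quotient_def)
    have "trans_refl_rel S `` {u} = dihedral_orbit u" if "u \<in> S" for u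
      using orbS[OF that] that by (auto simp: trans_refl_rel_def trans_refl_equiv_iff)
    then show "S // trans_refl_rel S = dihedral_orbit ` S"
      by (auto simp: quotient_def)
  qed
  have orb_f: "translation_orbit (f w) = f ` translation_orbit w"
    "dihedral_orbit (f w) = f ` dihedral_orbit w" if w: "w \<in> words A n" for w
    using w by (auto simp: dihedral_orbit_def translation_orbit_def image_image image_Un tr re)
  have orb_words: "translation_orbit w \<subseteq> words A n" "dihedral_orbit w \<subseteq> words A n" if "w \<in> words A n" for w
    using that by (auto simp: dihedral_orbit_def translation_orbit_def)
  have card_orb: "card (translation_orbit ` f ` W) = card (translation_orbit ` W)"
    "card (dihedral_orbit ` f ` W) = card (dihedral_orbit ` W)" if W: "W \<subseteq> words A n" for W
  proof -
    have inj_img: "inj_on ((`) f) (Pow (words A n))" by (rule inj_on_image_Pow[OF inj])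
    have "translation_orbit ` f ` W = (`) f ` translation_orbit ` W"
      unfolding image_image using W orb_f by (intro image_cong) auto
    moreover have "inj_on ((`) f) (translation_orbit ` W)"
      using orb_words(1) W by (intro inj_on_subset[OF inj_img]) blast
    ultimately show "card (translation_orbit ` f ` W) = card (translation_orbit ` W)"
      by (simp add: card_image)
    have "dihedral_orbit ` f ` W = (`) f ` dihedral_orbit ` W"
      unfolding image_image using W orb_f by (intro image_cong) auto
    moreover have "inj_on ((`) f) (dihedral_orbit ` W)"
      using orb_words(2) W by (intro inj_on_subset[OF inj_img]) blast
    ultimately show "card (dihedral_orbit ` f ` W) = card (dihedral_orbit ` W)"
      by (simp add: card_image)
  qed
  have "periodic m (f w) \<longleftrightarrow> periodic m w" if w: "w \<in> words A n" for m w
    using inj_on_eq_iff[OF inj, of "translate (int m) w" w] w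
    by (simp add: periodic_iff_translate tr)
  then have prim_f: "primitive n (f w) \<longleftrightarrow> primitive n w" if "w \<in> words A n" for w
    using that by (simp add: primitive_def)
  have prim: "{u \<in> S. primitive n u} = f ` primitive_words A n"
    using prim_f by (auto simp: S primitive_words_def)
  have prim_orb: "(\<forall>v\<in>translation_orbit u. primitive n v) \<longleftrightarrow> primitive n u"
    "(\<forall>v\<in>dihedral_orbit u. primitive n v) \<longleftrightarrow> primitive n u" for u
  proof -
    have self: "u \<in> translation_orbit u"
      unfolding translation_orbit_def by (rule range_eqI[of _ _ 0]) (simp add: translate_0)
    show "(\<forall>v\<in>translation_orbit u. primitive n v) \<longleftrightarrow> primitive n u"
      using self by (auto simp: translation_orbit_def)
    show "(\<forall>v\<in>dihedral_orbit u. primitive n v) \<longleftrightarrow> primitive n u"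
      using self by (auto simp: dihedral_orbit_def translation_orbit_def)
  qed
  have classes: "primitive_classes n (translation_orbit ` S) = translation_orbit ` f ` primitive_words A n"
    "primitive_classes n (dihedral_orbit ` S) = dihedral_orbit ` f ` primitive_words A n"
    unfolding prim[symmetric] primitive_classes_def using prim_orb by auto
  show "real (card (S // trans_rel S)) = necklaces (card A) n"
    unfolding quot unfolding S using card_orb card_word_necklaces[OF A n] by simp
  show "real (card (S // trans_refl_rel S)) = bracelets (card A) n"
    unfolding quot unfolding S using card_orb card_word_bracelets[OF A n] by simp
  have sub: "primitive_words A n \<subseteq> words A n" by (auto simp: primitive_words_def)
  show "real (card (primitive_classes n (S // trans_rel S))) = lyndon_words (card A) n"
    unfolding quot classes using card_orb[OF sub] card_word_lyndon[OF A n] by simp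
  show "real (card (primitive_classes n (S // trans_refl_rel S))) = lyndon_bracelets (card A) n"
    unfolding quot classes using card_orb[OF sub] card_word_lyndon_bracelets[OF A n] by simp
qed

section \<open>Asymptotic stability of contractive vector fields\<close>

text \<open>Otherwise there is a first time at which \<open>f\<close> is not below \<open>g\<close>, which contradicts \<open>step\<close>.\<close>

lemma stays_below:
  fixes f g :: "real \<Rightarrow> real"
  assumes "continuous_on {0..} f" "continuous_on {0..} g" "f 0 < g 0"
    and step: "\<And>t. 0 < t \<Longrightarrow> (\<And>s. 0 \<le> s \<Longrightarrow> s < t \<Longrightarrow> f s < g s) \<Longrightarrow> f t < g t"
    and "0 \<le> t"
  shows "f t < g t"
proof (rule ccontr)
  assume "\<not> f t < g t"
  define B where "B = {s \<in> {0..t}. g s \<le> f s}"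
  have sub: "{0..t} \<subseteq> {0..}" by auto
  have "closed B"
    unfolding B_def
    by (intro continuous_on_closed_Collect_le continuous_on_subset[OF assms(1) sub]
        continuous_on_subset[OF assms(2) sub]) auto
  moreover have "bounded B"
    by (rule bounded_subset[of "{0..t}"]) (auto simp: B_def)
  ultimately have "compact B"
    by (simp add: compact_eq_bounded_closed)
  moreover have "t \<in> B"
    using \<open>\<not> f t < g t\<close> \<open>0 \<le> t\<close> by (auto simp: B_def)
  ultimately obtain m where m: "m \<in> B" "\<And>s. s \<in> B \<Longrightarrow> m \<le> s"
    using compact_attains_inf[of B] by blast
  have "m \<noteq> 0" and "0 \<le> m"
    using m(1) \<open>f 0 < g 0\<close> by (auto simp: B_def)
  moreover have "f s < g s" if "0 \<le> s" "s < m" for s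
    using m that by (fastforce simp: B_def not_le)
  ultimately have "f m < g m"
    by (metis step order_less_le)
  then show False
    using m(1) by (auto simp: B_def)
qed

lemma has_vector_derivative_at_interior:
  assumes "(x has_vector_derivative x') (at t within {0..})" "0 < (t::real)"
  shows "(x has_vector_derivative x') (at t)"
  using assms by (metis at_within_interior interior_real_atLeast greaterThan_iff)

lemma solves_from_continuous: "solves_from F x0 x \<Longrightarrow> continuous_on {0..} x"
  unfolding solves_from_def
  by (rule continuous_on_vector_derivative) auto

text \<open>Write \<open>P X\<close> for the Euler step \<open>X + h F X\<close>, so that the equation is \<open>x' = (P x - x) / h\<close>. Then
  \<open>z t = exp (t / h) (x t - p)\<close> satisfies \<open>z' = exp (t / h) (P x - P p) / h\<close>, whose norm is at most
  \<open>lam / h\<close> times that of \<open>z\<close> while \<open>x\<close> is in the ball. Hence \<open>z\<close> stays below \<open>r * exp (lam t / h)\<close>,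
  and this bound in turn keeps \<open>x\<close> in the ball. The estimate covers every solution
  that starts near \<open>p\<close>.\<close>

lemma contraction_step_decay:
  fixes F :: "'v::real_normed_vector \<Rightarrow> 'v"
  assumes h: "0 < h" and F0: "F p = 0"
    and lip: "lam-lipschitz_on (cball p \<rho>) (\<lambda>X. X + h *\<^sub>R F X)" and lam1: "lam < 1"
    and x: "solves_from F x0 x" and x0: "norm (x0 - p) < r" and r: "r \<le> \<rho>"
    and t: "0 \<le> t"
  shows "norm (x t - p) < r * exp (- ((1 - lam) / h) * t)"
proof -
  note lam = lipschitz_on_nonneg[OF lip] lam1
  define z where "z s = exp (s / h) *\<^sub>R (x s - p)" for s
  define z' where "z' s = (exp (s / h) / h) *\<^sub>R (x s + h *\<^sub>R F (x s) - p)" for s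
  define g where "g s = r * exp (lam * s / h)" for s
  have x00: "x 0 = x0" and
    dx: "\<And>s. 0 \<le> s \<Longrightarrow> (x has_vector_derivative F (x s)) (at s within {0..})"
    using x by (auto simp: solves_from_def)
  have dz: "(z has_vector_derivative z' s) (at s)" if "0 < s" for s
  proof -
    have 1: "(x has_vector_derivative F (x s)) (at s)"
      using dx[of s] that by (intro has_vector_derivative_at_interior) auto
    have "((\<lambda>s. exp (s / h)) has_field_derivative exp (s / h) / h) (at s)"
      using h by (auto intro!: derivative_eq_intros)
    then have "((\<lambda>s. exp (s / h) *\<^sub>R (x s - p)) has_vector_derivative
        (exp (s / h) *\<^sub>R F (x s) + (exp (s / h) / h) *\<^sub>R (x s - p))) (at s)"
      by (rule has_vector_derivative_scaleR)
         (use 1 in \<open>simp add: has_vector_derivative_diff_const\<close>)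
    moreover have "exp (s / h) *\<^sub>R F (x s) + (exp (s / h) / h) *\<^sub>R (x s - p) = z' s"
      using h by (simp add: z'_def algebra_simps)
    ultimately show ?thesis
      unfolding z_def by simp
  qed
  have contx: "continuous_on {0..} x"
    using x by (rule solves_from_continuous)
  have contz: "continuous_on {0..} z"
    unfolding z_def by (intro continuous_intros contx) (use h in auto)
  have contg: "continuous_on A g" for A
    unfolding g_def by (intro continuous_intros) (use h in auto)
  have r0: "0 < r"
    using x0 norm_ge_zero[of "x0 - p"] by linarith
  have "norm (z t) < g t"
  proof (rule stays_below[of "\<lambda>s. norm (z s)" g])
    show "continuous_on {0..} (\<lambda>s. norm (z s))"
      by (intro continuous_intros contz)
    show "norm (z 0) < g 0"
      using x0 x00 by (simp add: z_def g_def)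
    fix t :: real
    assume t: "0 < t" and below: "\<And>s. 0 \<le> s \<Longrightarrow> s < t \<Longrightarrow> norm (z s) < g s"
    have "norm (z t - z 0) \<le> g t - g 0"
    proof (rule differentiable_bound_general[where f' = z' and \<phi>' = "\<lambda>s. lam / h * g s"])
      show "continuous_on {0..t} z"
        using contz by (rule continuous_on_subset) auto
      fix s assume s: "0 < s" "s < t"
      show "(z has_vector_derivative z' s) (at s)"
        by (rule dz) fact
      show "(g has_vector_derivative lam / h * g s) (at s)"
        unfolding g_def has_real_derivative_iff_has_vector_derivative[symmetric]
        using h by (auto intro!: derivative_eq_intros)
      have bs: "norm (z s) < g s"
        using below s by simp
      then have "exp (s / h) * norm (x s - p) < r * exp (lam * s / h)"
        by (simp add: z_def g_def)
      also have "\<dots> \<le> r * exp (s / h)"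
        using r0 h s lam by (simp add: divide_right_mono)
      finally have "norm (x s - p) < r"
        by (simp add: mult.commute)
      then have "x s \<in> cball p \<rho>" "p \<in> cball p \<rho>"
        using r r0 by (auto simp: dist_norm norm_minus_commute)
      from lipschitz_onD[OF lip this] have "norm (x s + h *\<^sub>R F (x s) - p) \<le> lam * norm (x s - p)"
        by (simp add: F0 dist_norm)
      then have "norm (z' s) \<le> (exp (s / h) / h) * (lam * norm (x s - p))"
        unfolding z'_def using h by (simp add: divide_right_mono)
      also have "\<dots> = lam / h * norm (z s)"
        by (simp add: z_def)
      also have "\<dots> \<le> lam / h * g s"
        using bs lam h by (intro mult_left_mono) auto
      finally show "norm (z' s) \<le> lam / h * g s" .
    qed (use t contg in auto)
    then have "norm (z t) \<le> norm (z 0) + (g t - g 0)"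
      using norm_triangle_ineq2[of "z t" "z 0"] by linarith
    then show "norm (z t) < g t"
      using x0 x00 by (simp add: z_def g_def)
  qed (use contg t in auto)
  then have "norm (x t - p) * exp (t / h) < r * exp (lam * t / h)"
    by (simp add: z_def g_def mult.commute)
  then have "norm (x t - p) < r * exp (lam * t / h) / exp (t / h)"
    by (simp add: pos_less_divide_eq)
  also have "\<dots> = r * exp (- ((1 - lam) / h) * t)"
  proof -
    have "- ((1 - lam) / h) * t = lam * t / h - t / h"
      using h by (simp add: field_simps)
    then show ?thesis by (simp only: exp_diff times_divide_eq_right)
  qed
  finally show ?thesis .
qed

text \<open>By variation of constants, solutions of \<open>x' = (P x - x) / h\<close> are the fixed points of
  \<open>x t = exp (- t / h) x0 + \<integral> exp (- (t - s) / h) / h P (x s) ds\<close>. The kernel has mass below 1, so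
  on the bounded continuous functions with values in the ball this map has the Lipschitz constant
  \<open>lam\<close> of \<open>P\<close>. The solution is obtained on the whole half line at once.\<close>

lemma contraction_step_existence:
  fixes F :: "'v::banach \<Rightarrow> 'v"
  assumes h: "0 < h" and F0: "F p = 0"
    and lip: "lam-lipschitz_on (cball p \<rho>) (\<lambda>X. X + h *\<^sub>R F X)" and lam1: "lam < 1"
    and x0: "norm (x0 - p) \<le> \<rho>"
  shows "\<exists>x. solves_from F x0 x"
proof -
  note lam = lipschitz_on_nonneg[OF lip] lam1
  define P where "P X = X + h *\<^sub>R F X" for X
  define B where "B = cball p \<rho>"
  have \<rho>: "0 \<le> \<rho>" using x0 norm_ge_zero[of "x0 - p"] by linarith
  have pB: "p \<in> B" using \<rho> by (simp add: B_def)
  have Pp: "P p = p" by (simp add: P_def F0)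
  have Plip: "norm (P X - P Y) \<le> lam * norm (X - Y)" if "X \<in> B" "Y \<in> B" for X Y
    using lipschitz_onD[OF lip] that by (simp add: P_def B_def dist_norm)
  have PB: "norm (P X - p) \<le> \<rho>" if "X \<in> B" for X
  proof -
    have "norm (P X - P p) \<le> lam * norm (X - p)"
      using that pB by (rule Plip)
    also have "\<dots> \<le> 1 * norm (X - p)"
      using lam by (intro mult_right_mono) auto
    also have "\<dots> \<le> \<rho>"
      using that by (simp add: B_def dist_norm norm_minus_commute)
    finally show ?thesis by (simp add: Pp)
  qed
  have contP: "continuous_on B P"
    using lipschitz_on_continuous_on[OF lip] by (simp add: B_def P_def[abs_def])
  define E where "E s = exp (s / h) / h" for s
  have intE: "(E has_integral exp (t / h) - 1) {0..t}" if "0 \<le> t" for t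
  proof -
    have "((\<lambda>s. exp (s / h)) has_real_derivative E s) (at s within {0..t})" for s
      unfolding E_def using h by (auto intro!: derivative_eq_intros)
    then have "(E has_integral exp (t / h) - exp (0 / h)) {0..t}"
      using that
      by (intro fundamental_theorem_of_calculus)
         (simp_all add: has_real_derivative_iff_has_vector_derivative)
    then show ?thesis by simp
  qed
  have E0: "0 \<le> E s" for s using h by (simp add: E_def)
  have contE: "continuous_on A E" for A
    unfolding E_def by (intro continuous_intros) (use h in auto)
  define I where "I y t = integral {0..t} (\<lambda>s. E s *\<^sub>R (P (y s) - p))" for y t
  define U where "U y t = p + exp (- (t / h)) *\<^sub>R ((x0 - p) + I y t)" for y t
  define S where "S = {y :: real \<Rightarrow>\<^sub>C 'v. \<forall>t. y t \<in> B}"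
  have contint: "continuous_on A (\<lambda>s. E s *\<^sub>R (P (y s) - p))" if "y \<in> S"
    for y :: "real \<Rightarrow>\<^sub>C 'v" and A
    using that
    by (intro continuous_intros contE continuous_on_compose2[OF contP]) (auto simp: S_def)
  have int: "(\<lambda>s. E s *\<^sub>R (P (y s) - p)) integrable_on {0..t}" if "y \<in> S"
    for y :: "real \<Rightarrow>\<^sub>C 'v" and t
    using contint[OF that] by (rule integrable_continuous_real)
  have dI: "(I y has_vector_derivative E t *\<^sub>R (P (y t) - p)) (at t within {0..})"
    if "y \<in> S" "0 \<le> t" for y :: "real \<Rightarrow>\<^sub>C 'v" and t
  proof -
    have "(I y has_vector_derivative E t *\<^sub>R (P (y t) - p)) (at t within {0..t+1})"
      unfolding I_def
      by (rule integral_has_vector_derivative[OF contint[OF that(1)]]) (use that in auto)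
    moreover have "at t within {0..t+1} = at t within {0..}"
      by (rule at_within_nhd[of _ "{..<t+1}"]) (use that in auto)
    ultimately show ?thesis by simp
  qed
  have contI: "continuous_on {0..} (I y)" if "y \<in> S" for y :: "real \<Rightarrow>\<^sub>C 'v"
    using dI[OF that] by (intro continuous_on_vector_derivative) auto
  have UB: "norm (U y t - p) \<le> \<rho>" if y: "y \<in> S" and t: "0 \<le> t" for y :: "real \<Rightarrow>\<^sub>C 'v" and t
  proof -
    have "norm (I y t) \<le> integral {0..t} (\<lambda>s. E s * \<rho>)"
      unfolding I_def
    proof (rule integral_norm_bound_integral[OF int[OF y]])
      show "(\<lambda>s. E s * \<rho>) integrable_on {0..t}"
        by (intro integrable_continuous_real continuous_intros contE)
      show "norm (E s *\<^sub>R (P (y s) - p)) \<le> E s * \<rho>" if "s \<in> {0..t}" for s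
        using PB[of "y s"] y E0[of s] by (auto simp: S_def intro!: mult_left_mono)
    qed
    also have "\<dots> = (exp (t / h) - 1) * \<rho>"
      using has_integral_mult_left[OF intE[OF t], of \<rho>] by (rule integral_unique)
    finally have "norm ((x0 - p) + I y t) \<le> \<rho> + (exp (t / h) - 1) * \<rho>"
      using x0 norm_triangle_ineq[of "x0 - p" "I y t"] by linarith
    also have "\<dots> = exp (t / h) * \<rho>" by (simp add: algebra_simps)
    finally show ?thesis
      by (simp add: U_def exp_minus inverse_eq_divide pos_divide_le_eq mult.commute)
  qed
  have Udiff: "norm (U y t - U y' t) \<le> lam * dist y y'"
    if y: "y \<in> S" "y' \<in> S" and t: "0 \<le> t" for y y' :: "real \<Rightarrow>\<^sub>C 'v" and t
  proof -
    have "I y t - I y' t = integral {0..t} (\<lambda>s. E s *\<^sub>R (P (y s) - P (y' s)))"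
      using integral_diff[OF int[OF y(1)] int[OF y(2)], of t]
      by (simp add: I_def scaleR_diff_right[symmetric])
    also have "norm \<dots> \<le> integral {0..t} (\<lambda>s. E s * (lam * dist y y'))"
    proof (rule integral_norm_bound_integral)
      show "(\<lambda>s. E s *\<^sub>R (P (y s) - P (y' s))) integrable_on {0..t}"
        using integrable_diff[OF int[OF y(1)] int[OF y(2)]]
        by (simp add: scaleR_diff_right[symmetric])
      show "(\<lambda>s. E s * (lam * dist y y')) integrable_on {0..t}"
        by (intro integrable_continuous_real continuous_intros contE)
      show "norm (E s *\<^sub>R (P (y s) - P (y' s))) \<le> E s * (lam * dist y y')"
        if "s \<in> {0..t}" for s
      proof -
        have "norm (P (y s) - P (y' s)) \<le> lam * norm (y s - y' s)"
          by (rule Plip) (use y in \<open>auto simp: S_def\<close>)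
        also have "\<dots> \<le> lam * dist y y'"
          using dist_bounded[of y s y'] lam by (intro mult_left_mono) (auto simp: dist_norm)
        finally show ?thesis
          using E0[of s] by (auto intro!: mult_left_mono)
      qed
    qed
    also have "\<dots> = (exp (t / h) - 1) * (lam * dist y y')"
      using has_integral_mult_left[OF intE[OF t], of "lam * dist y y'"] by (rule integral_unique)
    also have "\<dots> \<le> exp (t / h) * (lam * dist y y')"
      using lam by (intro mult_right_mono) auto
    finally have "norm (I y t - I y' t) \<le> exp (t / h) * (lam * dist y y')" .
    moreover have "U y t - U y' t = exp (- (t / h)) *\<^sub>R (I y t - I y' t)"
      by (simp add: U_def algebra_simps)
    ultimately show ?thesis
      by (simp add: exp_minus inverse_eq_divide pos_divide_le_eq mult.commute)
  qed
  \<comment> \<open>The bounded continuous functions live on the whole real line, so they are extended as constants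
    to negative times.\<close>
  define T where "T y = Bcontfun (\<lambda>t. U y (max 0 t))" for y :: "real \<Rightarrow>\<^sub>C 'v"
  have T: "T y t = U y (max 0 t)" if y: "y \<in> S" for y t
  proof -
    have "continuous_on {0..} (U y)"
      unfolding U_def by (intro continuous_intros contI y) (use h in auto)
    then have "continuous_on UNIV (\<lambda>t. U y (max 0 t))"
      by (rule continuous_on_compose2) (auto intro!: continuous_intros)
    moreover have "norm (U y (max 0 t)) \<le> \<rho> + norm p" for t
      using UB[OF y, of "max 0 t"] norm_triangle_ineq[of "U y (max 0 t) - p" p] by simp
    ultimately have "(\<lambda>t. U y (max 0 t)) \<in> bcontfun"
      by (rule bcontfun_normI)
    then show ?thesis
      unfolding T_def by (simp add: Bcontfun_inverse)
  qed
  have "S = PiC UNIV (\<lambda>_. B)"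
    by (auto simp: S_def mem_PiC_iff Pi_iff)
  then have "closed S"
    by (simp add: closed_PiC B_def)
  then have "complete S"
    by (simp add: complete_eq_closed)
  moreover have "const_bcontfun p \<in> S"
    using pB by (simp add: S_def)
  moreover have "T ` S \<subseteq> S"
    using UB by (auto simp: S_def T B_def dist_norm norm_minus_commute)
  moreover have "dist (T y) (T y') \<le> lam * dist y y'" if "y \<in> S" "y' \<in> S" for y y'
    by (rule dist_bound) (use Udiff that in \<open>auto simp: T dist_norm\<close>)
  ultimately have "\<exists>!y. y \<in> S \<and> T y = y"
    using lam by (intro Banach_fix[of S lam T]) auto
  then obtain y where y: "y \<in> S" "T y = y"
    by (elim ex1E conjE)
  have yU: "y t = U y t" if "0 \<le> t" for t
    using T[OF y(1), of t] y(2) that by simp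
  have "(apply_bcontfun y has_vector_derivative F (y t)) (at t within {0..})" if t: "0 \<le> t" for t
  proof -
    have "((\<lambda>t. exp (- (t / h))) has_field_derivative - exp (- (t / h)) / h) (at t within {0..})"
      using h by (auto intro!: derivative_eq_intros)
    then have "(U y has_vector_derivative
        exp (- (t / h)) *\<^sub>R (E t *\<^sub>R (P (y t) - p)) + (- exp (- (t / h)) / h) *\<^sub>R (x0 - p + I y t))
        (at t within {0..})"
      unfolding U_def add.commute[of p] has_vector_derivative_add_const
      by (rule has_vector_derivative_scaleR)
         (use dI[OF y(1) t] in \<open>simp add: add.commute[of "x0 - p"] has_vector_derivative_add_const\<close>)
    also have "exp (- (t / h)) *\<^sub>R (E t *\<^sub>R (P (y t) - p)) + (- exp (- (t / h)) / h) *\<^sub>R (x0 - p + I y t)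
       = (1 / h) *\<^sub>R (P (y t) - p) - (1 / h) *\<^sub>R (U y t - p)"
      by (simp add: E_def U_def exp_minus)
    also have "\<dots> = F (y t)"
      unfolding yU[OF t, symmetric] scaleR_diff_right[symmetric] P_def using h by simp
    finally show ?thesis
      by (rule has_vector_derivative_transform[rotated 2]) (use t yU in auto)
  qed
  moreover have "y 0 = x0"
    using yU[of 0] by (simp add: U_def I_def)
  ultimately show ?thesis
    unfolding solves_from_def by blast
qed

text \<open>The decay estimate gives both halves of asymptotic stability: its initial radius \<open>r\<close> bounds the
  solution for all times, and the exponential factor makes it converge.\<close>

lemma contraction_step_imp_asymptotically_stable:
  fixes F :: "'v::banach \<Rightarrow> 'v"
  assumes h: "0 < h" and F0: "F p = 0" and \<rho>: "0 < \<rho>"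
    and lip: "lam-lipschitz_on (cball p \<rho>) (\<lambda>X. X + h *\<^sub>R F X)" and lam1: "lam < 1"
  shows "asymptotically_stable F p"
proof -
  note lam = lipschitz_on_nonneg[OF lip] lam1
  note decay = contraction_step_decay[OF h F0 lip lam1]
  note ex = contraction_step_existence[OF h F0 lip lam1]
  have "lyapunov_stable F p"
    unfolding lyapunov_stable_def
  proof (intro allI impI)
    fix \<epsilon> :: real assume \<epsilon>: "0 < \<epsilon>"
    define r where "r = min \<epsilon> \<rho>"
    have r: "0 < r" "r \<le> \<rho>" "r \<le> \<epsilon>"
      using \<epsilon> \<rho> by (auto simp: r_def)
    have "norm (x t - p) < \<epsilon>" if "norm (x0 - p) < r" "solves_from F x0 x" "0 \<le> t" for x0 x t
    proof -
      have "norm (x t - p) < r * exp (- ((1 - lam) / h) * t)"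
        by (rule decay[OF that(2,1) r(2) that(3)])
      also have "\<dots> \<le> r * 1"
        using r h lam that by (intro mult_left_mono) auto
      finally show ?thesis using r by simp
    qed
    moreover have "\<exists>x. solves_from F x0 x" if "norm (x0 - p) < r" for x0
      using that r by (intro ex) auto
    ultimately show "\<exists>\<delta>>0. \<forall>x0. norm (x0 - p) < \<delta> \<longrightarrow>
        (\<exists>x. solves_from F x0 x) \<and>
        (\<forall>x. solves_from F x0 x \<longrightarrow> (\<forall>t\<ge>0. norm (x t - p) < \<epsilon>))"
      by (intro exI[of _ r] conjI allI impI r) auto
  qed
  moreover have "locally_attractive F p"
    unfolding locally_attractive_def
  proof (intro exI[of _ \<rho>] conjI allI impI \<rho>)
    fix x0 assume x0: "norm (x0 - p) < \<rho>"
    show "\<exists>x. solves_from F x0 x"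
      using x0 by (intro ex) auto
    fix x assume x: "solves_from F x0 x"
    have "((\<lambda>t. \<rho> * exp (- ((1 - lam) / h) * t)) \<longlongrightarrow> 0) at_top"
    proof -
      have "filterlim (\<lambda>t. ((1 - lam) / h) * t) at_top at_top"
        using lam h by (intro filterlim_tendsto_pos_mult_at_top[OF tendsto_const _ filterlim_ident]) auto
      then have "((\<lambda>t. exp (- (((1 - lam) / h) * t))) \<longlongrightarrow> 0) at_top"
        by (rule filterlim_compose[OF exp_at_bot filterlim_compose[OF filterlim_uminus_at_bot_at_top]])
      then show ?thesis
        using tendsto_mult_right_zero[of "\<lambda>t. exp (- (((1 - lam) / h) * t))" at_top \<rho>]
        by (simp only: mult_minus_left)
    qed
    then have "((\<lambda>t. x t - p) \<longlongrightarrow> 0) at_top"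
    proof (rule Lim_null_comparison[rotated])
      show "\<forall>\<^sub>F t in at_top. norm (x t - p) \<le> \<rho> * exp (- ((1 - lam) / h) * t)"
        using eventually_ge_at_top[of 0]
        by eventually_elim (rule less_imp_le[OF decay[OF x x0 order.refl]])
    qed
    then show "(x \<longlongrightarrow> p) at_top"
      by (simp add: LIM_zero_iff)
  qed
  ultimately show ?thesis
    using F0 by (simp add: asymptotically_stable_def)
qed

section \<open>Positivity for cooperative lattice systems\<close>

lemma nondecreasing_from_zero:
  fixes f :: "real \<Rightarrow> real"
  assumes df: "\<And>s. 0 \<le> s \<Longrightarrow> (f has_real_derivative f' s) (at s within {0..})"
    and nonneg: "\<And>s. 0 < s \<Longrightarrow> s < t \<Longrightarrow> 0 \<le> f' s" and "0 \<le> t"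
  shows "f 0 \<le> f t"
proof (rule DERIV_nonneg_imp_increasing_open[of 0 t f])
  have "continuous_on {0..} f"
    using df by (intro DERIV_continuous_on) auto
  then show "continuous_on {0..t} f"
    by (rule continuous_on_subset) auto
  fix s assume s: "0 < s" "s < t"
  then have "(f has_real_derivative f' s) (at s)"
    using df[of s] unfolding has_real_derivative_iff_has_vector_derivative
    by (intro has_vector_derivative_at_interior) auto
  then show "\<exists>y. (f has_real_derivative y) (at s) \<and> 0 \<le> y"
    using nonneg s by blast
qed fact

lemma has_real_derivative_apply_bcontfun:
  assumes "(x has_vector_derivative X) (at t within A)"
  shows "((\<lambda>s. apply_bcontfun (x s) i) has_real_derivative apply_bcontfun X i) (at t within A)"
proof -
  have "bounded_linear (\<lambda>Y. apply_bcontfun Y i :: real)"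
    by (rule bounded_linear_intro[of _ 1])
       (use norm_bounded[where 'b = real and x = i] in \<open>simp_all add: bounded_iff\<close>)
  from bounded_linear.has_vector_derivative[OF this assms] show ?thesis
    by (simp add: has_real_derivative_iff_has_vector_derivative)
qed

text \<open>For \<open>z t = exp (M t) v t\<close> all coefficients are nonnegative, so the entries of \<open>z\<close> can decrease only
  as fast as the negative parts of \<open>z\<close> allow. Infinitely many entries need not have a first one to
  become negative; therefore the negative part is measured uniformly, by the distance to the cone of
  nonnegative sequences. It stays below \<open>e * exp (K t)\<close> for every \<open>e > 0\<close>, hence it vanishes.\<close>

lemma cooperative_nonneg:
  fixes v :: "real \<Rightarrow> (int \<Rightarrow>\<^sub>C real)"
  assumes cont: "continuous_on {0..} v"
    and dv: "\<And>t i. 0 \<le> t \<Longrightarrow> ((\<lambda>s. v s i) has_real_derivative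
        d * (v t (i - 1) + v t (i + 1)) + b t i * v t i) (at t within {0..})"
    and d: "0 \<le> d" and b: "\<And>t i. 0 \<le> t \<Longrightarrow> \<bar>b t i\<bar> \<le> M"
    and v0: "\<And>i. 0 \<le> v 0 i" and t: "0 \<le> t"
  shows "0 \<le> v t i"
proof -
  have M: "0 \<le> M" using b[of 0 0] by simp
  define z where "z s = exp (M * s) *\<^sub>R v s" for s
  have dz: "((\<lambda>s. z s i) has_real_derivative
      d * (z t (i - 1) + z t (i + 1)) + (M + b t i) * z t i) (at t within {0..})"
    if "0 \<le> t" for t i
    unfolding z_def using dv[OF that, of i]
    by (auto intro!: derivative_eq_intros simp: algebra_simps)
  define C where "C = {Y :: int \<Rightarrow>\<^sub>C real. \<forall>i. 0 \<le> Y i}"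
  have C0: "0 \<in> C" by (simp add: C_def)
  have low: "- infdist Z C \<le> Z i" for Z :: "int \<Rightarrow>\<^sub>C real" and i
  proof -
    have "- Z i \<le> dist Z Y" if "Y \<in> C" for Y
    proof -
      have "0 \<le> Y i" using that by (simp add: C_def)
      then show ?thesis using dist_bounded[of Z i Y] by (simp add: dist_real_def)
    qed
    then have "- Z i \<le> infdist Z C"
      using C0 by (auto simp: infdist_def intro!: cINF_greatest)
    then show ?thesis by simp
  qed
  have up: "infdist Z C \<le> r" if "0 \<le> r" "\<And>i. - r \<le> Z i" for Z :: "int \<Rightarrow>\<^sub>C real" and r
  proof -
    have "Z + const_bcontfun r \<in> C"
      unfolding C_def
    proof (intro CollectI allI)
      show "0 \<le> (Z + const_bcontfun r) i" for i using that(2)[of i] by simp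
    qed
    then have "infdist Z C \<le> dist Z (Z + const_bcontfun r)"
      by (rule infdist_le)
    also have "\<dots> \<le> r"
      by (rule dist_bound) (use that in \<open>simp add: dist_real_def\<close>)
    finally show ?thesis .
  qed
  \<comment> \<open>An upper bound for the sum \<open>2 * d + (M + b t i)\<close> of the coefficients of \<open>z\<close>.\<close>
  define K where "K = 2 * d + 2 * M"
  have "infdist (z t) C < e * exp (K * t)" if e: "0 < e" for e
  proof (rule stays_below[of "\<lambda>s. infdist (z s) C" "\<lambda>s. e * exp (K * s)"])
    show "continuous_on {0..} (\<lambda>s. infdist (z s) C)"
      unfolding z_def by (intro continuous_intros cont)
    show "continuous_on {0..} (\<lambda>s. e * exp (K * s))"
      by (intro continuous_intros)
    have "z 0 \<in> C" using v0 by (simp add: z_def C_def)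
    then show "infdist (z 0) C < e * exp (K * 0)" using e by simp
    fix t :: real
    assume t: "0 < t" and below: "\<And>s. 0 \<le> s \<Longrightarrow> s < t \<Longrightarrow> infdist (z s) C < e * exp (K * s)"
    have "- (e * exp (K * t) - e) \<le> z t i" for i
    proof -
      have "z 0 i + e * exp (K * 0) \<le> z t i + e * exp (K * t)"
      proof (rule nondecreasing_from_zero[of "\<lambda>s. z s i + e * exp (K * s)"])
        show "((\<lambda>s. z s i + e * exp (K * s)) has_real_derivative
            (d * (z s (i - 1) + z s (i + 1)) + (M + b s i) * z s i + K * e * exp (K * s)))
            (at s within {0..})" if "0 \<le> s" for s
          by (auto intro!: derivative_eq_intros dz that)
        fix s assume s: "0 < s" "s < t"
        define m where "m = e * exp (K * s)"
        have m: "0 \<le> m" using e by (simp add: m_def)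
        have zm: "- m \<le> z s j" for j
          using low[of "z s" j] below[of s] s by (simp add: m_def)
        have "d * (- m + - m) \<le> d * (z s (i - 1) + z s (i + 1))"
          using zm d by (intro mult_left_mono add_mono) auto
        moreover have "(M + b s i) * (- m) \<le> (M + b s i) * z s i"
          using zm b[of s i] s by (intro mult_left_mono) auto
        moreover have "(M + b s i) * m \<le> (2 * M) * m"
          using m b[of s i] s by (intro mult_right_mono) auto
        moreover have "K * e * exp (K * s) = 2 * (d * m) + 2 * (M * m)"
          by (simp add: K_def m_def algebra_simps)
        ultimately show "0 \<le> d * (z s (i - 1) + z s (i + 1)) + (M + b s i) * z s i
            + K * e * exp (K * s)"
          by (simp add: algebra_simps)
      qed (use t in auto)
      moreover have "0 \<le> z 0 i" using v0 by (simp add: z_def)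
      ultimately show ?thesis by simp
    qed
    then have "infdist (z t) C \<le> e * exp (K * t) - e"
      using e t d M by (intro up) (auto simp: K_def)
    then show "infdist (z t) C < e * exp (K * t)" using e by simp
  qed fact
  from this[of "e / exp (K * t)" for e] have "infdist (z t) C \<le> 0 + e" if "0 < e" for e
    using that by (simp add: less_imp_le)
  then have "infdist (z t) C \<le> 0"
    by (rule field_le_epsilon)
  then have "0 \<le> z t i"
    using low[of "z t" i] by simp
  then show ?thesis by (simp add: z_def zero_le_mult_iff)
qed

section \<open>Completeness of the space of bounded double sequences\<close>

text \<open>The usual distance induces the discrete topology of the integers. As functions on a metric space,
  the bounded double sequences form a complete space, which both the contraction arguments and the
  integrals in variation of constants rely on.\<close>

instantiation int :: metric_space
begin

definition dist_int :: "int \<Rightarrow> int \<Rightarrow> real" where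
  "dist_int x y = \<bar>real_of_int x - real_of_int y\<bar>"

definition uniformity_int :: "(int \<times> int) filter" where
  "uniformity_int = (INF e\<in>{0 <..}. principal {(x, y). dist x y < e})"

instance
proof
  fix S :: "int set" and x y z :: int
  have dist_less_1: "x = y" if "dist x y < 1" for x y :: int
    using that unfolding dist_int_def by linarith
  show "uniformity = (INF e\<in>{0 <..}. principal {(x::int, y). dist x y < e})"
    by (rule uniformity_int_def)
  show "dist x y = 0 \<longleftrightarrow> x = y"
    by (simp add: dist_int_def)
  show "dist x y \<le> dist x z + dist y z"
    by (simp add: dist_int_def)
  have "\<forall>\<^sub>F (x', y) in uniformity. x' = x \<longrightarrow> y \<in> S" if "x \<in> S" for x
  proof -
    have "eventually (\<lambda>p. fst p = x \<longrightarrow> snd p \<in> S) (principal {(x :: int, y). dist x y < 1})"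
      using that by (auto simp: eventually_principal dest: dist_less_1)
    then show ?thesis
      unfolding uniformity_int_def case_prod_beta
      by (rule filter_leD[OF INF_lower, rotated]) simp
  qed
  then show "open S \<longleftrightarrow> (\<forall>x\<in>S. \<forall>\<^sub>F (x', y) in uniformity. x' = x \<longrightarrow> y \<in> S)"
    by (auto simp: open_discrete)
qed

end

instance bcontfun :: (metric_space, banach) banach ..

section \<open>Continuation of words to small coupling\<close>

text \<open>The difference quotient of \<open>g\<close>, extended continuously to the diagonal, where it is the derivative
  of \<open>g\<close>.\<close>

definition slope :: "real \<Rightarrow> real \<Rightarrow> real \<Rightarrow> real" where
  "slope a x y = (1 + a) * (x + y) - (x^2 + x * y + y^2) - a"

lemma nagumo_g_diff: "nagumo_g x a - nagumo_g y a = slope a x y * (x - y)"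
  by (simp add: nagumo_g_def slope_def power2_eq_square algebra_simps)

lemma lattice_rhs_diff:
  "lattice_rhs d a u i - lattice_rhs d a v i
   = d * ((u (i - 1) - v (i - 1)) + (u (i + 1) - v (i + 1))) + (slope a (u i) (v i) - 2 * d) * (u i - v i)"
  using nagumo_g_diff[of "u i" a "v i"] by (simp add: lattice_rhs_def algebra_simps)

text \<open>The bound on \<open>d\<close> is what keeps stationary sequences near words: at a point farther than \<open>radius\<close>
  from all three zeros, \<open>g\<close> exceeds \<open>radius ^ 3\<close> in absolute value, whereas the coupling of entries
  in \<open>[0, 1]\<close> contributes at most \<open>2 * d\<close>.\<close>

locale weak_coupling =
  fixes a d :: real
  assumes a: "0 < a" "a < 1" and d_pos: "0 < d" and d_small: "2 * d < (a * (1 - a) / 56) ^ 3"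
begin

text \<open>A common lower bound for the distances between the zeros \<open>0, a, 1\<close> of \<open>g\<close> and for the absolute
  values \<open>a, a * (1 - a), 1 - a\<close> of the derivative of \<open>g\<close> there.\<close>

definition gap where "gap = a * (1 - a)"

text \<open>Within twice this radius of a zero, \<open>slope\<close> differs from its value at the zero by at most
  \<open>11 * radius\<close>, which is less than \<open>gap / 4\<close>.\<close>

definition radius where "radius = gap / 56"

lemma gap: "0 < gap" "gap \<le> 1 / 4" "gap \<le> a" "gap \<le> 1 - a"
proof -
  show "0 < gap" using a by (simp add: gap_def)
  have "0 \<le> (a - 1 / 2)^2" by simp
  then show "gap \<le> 1 / 4" by (simp add: gap_def power2_eq_square algebra_simps)
  show "gap \<le> a" "gap \<le> 1 - a" using a by (auto simp: gap_def mult_le_cancel_left1 mult_le_cancel_right1)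
qed

lemma radius: "0 < radius" "radius \<le> 1 / 224" "gap = 56 * radius"
  using gap by (auto simp: radius_def)

lemma d_less: "2 * d < radius ^ 3"
  using d_small by (simp add: radius_def gap_def)

lemma d_le: "d \<le> gap * radius / 16"
proof -
  have "radius ^ 3 \<le> radius ^ 2 * 1"
    unfolding power3_eq_cube power2_eq_square using radius by (intro mult_left_mono) auto
  then show ?thesis
    using d_less radius(3) by (simp add: power2_eq_square) (smt (verit) radius(1) mult_pos_pos)
qed

lemma d_le': "d \<le> gap / 16" "d \<le> 1 / 64"
proof -
  have "gap * radius \<le> gap * 1" using radius gap by (intro mult_left_mono) auto
  then show "d \<le> gap / 16" using d_le by simp
  then show "d \<le> 1 / 64" using gap by simp
qed

lemma slope_root:
  assumes "w \<in> {0, a, 1}"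
  shows "gap \<le> \<bar>slope a w w\<bar>" "\<bar>slope a w w\<bar> \<le> 1"
    "w = a \<Longrightarrow> slope a w w = gap" "w \<noteq> a \<Longrightarrow> slope a w w \<le> - gap"
proof -
  consider "w = 0" | "w = a" | "w = 1" using assms by auto
  then have "slope a w w = (if w = 0 then - a else if w = 1 then - (1 - a) else gap)"
    using a by cases (auto simp: slope_def gap_def power2_eq_square algebra_simps)
  then show "gap \<le> \<bar>slope a w w\<bar>" "\<bar>slope a w w\<bar> \<le> 1"
    "w = a \<Longrightarrow> slope a w w = gap" "w \<noteq> a \<Longrightarrow> slope a w w \<le> - gap"
    using assms a gap by auto
qed

lemma slope_near_root:
  assumes w: "w \<in> {0, a, 1}" and x: "\<bar>x - w\<bar> \<le> 2 * radius" and y: "\<bar>y - w\<bar> \<le> 2 * radius"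
  shows "\<bar>slope a x y - slope a w w\<bar> \<le> gap / 4"
proof -
  define s t where "s = x - w" and "t = y - w"
  have st: "\<bar>s\<bar> \<le> 2 * radius" "\<bar>t\<bar> \<le> 2 * radius" using x y by (auto simp: s_def t_def)
  have eq: "slope a x y - slope a w w = (1 + a - 3 * w) * (s + t) - (s * s + s * t + t * t)"
    by (simp add: slope_def s_def t_def power2_eq_square algebra_simps)
  have "\<bar>1 + a - 3 * w\<bar> \<le> 2"
    using w a by auto
  moreover have "\<bar>s + t\<bar> \<le> 4 * radius"
    using st by linarith
  ultimately have 1: "\<bar>(1 + a - 3 * w) * (s + t)\<bar> \<le> 2 * (4 * radius)"
    unfolding abs_mult by (rule mult_mono) auto
  have prod: "\<bar>p * q\<bar> \<le> radius" if "\<bar>p\<bar> \<le> 2 * radius" "\<bar>q\<bar> \<le> 2 * radius" for p q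
  proof -
    have "\<bar>p\<bar> * \<bar>q\<bar> \<le> (2 * radius) * (1 / 2)"
      by (rule mult_mono) (use that radius in auto)
    then show ?thesis by (simp add: abs_mult)
  qed
  have "\<bar>s * s + s * t + t * t\<bar> \<le> 3 * radius"
    using prod[OF st(1) st(1)] prod[OF st(1) st(2)] prod[OF st(2) st(2)] by linarith
  then show ?thesis
    unfolding eq using 1 radius by linarith
qed

definition near :: "(int \<Rightarrow> real) \<Rightarrow> (int \<Rightarrow> real) \<Rightarrow> bool" where
  "near w u \<longleftrightarrow> (\<forall>i. \<bar>u i - w i\<bar> \<le> radius)"

lemma near_bcontfun:
  assumes "range w \<subseteq> {0, a, 1}" "near w u"
  shows "u \<in> bcontfun"
proof -
  have "\<bar>u i\<bar> \<le> 2" for i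
  proof -
    have "w i \<in> {0, a, 1}" using assms(1) by auto
    then have "\<bar>w i\<bar> \<le> 1" using a by auto
    moreover have "\<bar>u i - w i\<bar> \<le> radius" using assms(2) by (auto simp: near_def)
    ultimately show ?thesis using radius by linarith
  qed
  then show ?thesis by (auto simp: bcontfun_int_iff bounded_iff)
qed

text \<open>A Newton step for \<open>lattice_rhs\<close> with the derivative of the uncoupled system at the word \<open>w\<close>, which
  is diagonal.\<close>

definition newton :: "(int \<Rightarrow> real) \<Rightarrow> (int \<Rightarrow> real) \<Rightarrow> int \<Rightarrow> real" where
  "newton w u i = u i - lattice_rhs d a u i / slope a (w i) (w i)"

text \<open>The frozen derivative differs from the true difference quotients by at most a quarter of its size,
  and the coupling, bounded by \<open>4 * d\<close>, contributes at most another quarter.\<close>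

lemma newton_contraction:
  assumes w: "range w \<subseteq> {0, a, 1}" and uv: "near w u" "near w v" 
    and M: "\<And>i. \<bar>u i - v i\<bar> \<le> M"
  shows "\<bar>newton w u i - newton w v i\<bar> \<le> M / 2"
proof -
  define s where "s = slope a (w i) (w i)"
  define q where "q = slope a (u i) (v i)"
  define e where "e j = u j - v j" for j
  have wi: "w i \<in> {0, a, 1}" using w by auto
  have s: "gap \<le> \<bar>s\<bar>" using slope_root(1)[OF wi] by (simp add: s_def)
  then have s0: "s \<noteq> 0" using gap by auto
  have M0: "0 \<le> M" using M[of 0] by linarith
  have "\<bar>u i - w i\<bar> \<le> radius" "\<bar>v i - w i\<bar> \<le> radius" using uv by (auto simp: near_def)
  then have q: "\<bar>q - s\<bar> \<le> gap / 4"
    unfolding q_def s_def using radius by (intro slope_near_root[OF wi]) auto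
  have "s * (newton w u i - newton w v i)
      = s * (u i - v i) - (lattice_rhs d a u i - lattice_rhs d a v i)"
    using s0 by (simp add: newton_def s_def[symmetric] field_simps)
  also have "\<dots> = (s - q) * e i - d * (e (i - 1) - 2 * e i + e (i + 1))"
    unfolding lattice_rhs_diff by (simp add: q_def e_def algebra_simps)
  finally have "\<bar>s\<bar> * \<bar>newton w u i - newton w v i\<bar>
      = \<bar>(s - q) * e i - d * (e (i - 1) - 2 * e i + e (i + 1))\<bar>"
    by (simp add: abs_mult[symmetric])
  also have "\<dots> \<le> \<bar>s - q\<bar> * \<bar>e i\<bar> + d * \<bar>e (i - 1) - 2 * e i + e (i + 1)\<bar>"
    using abs_triangle_ineq4[of "(s - q) * e i" "d * (e (i - 1) - 2 * e i + e (i + 1))"] d_pos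
    by (simp add: abs_mult)
  also have "\<dots> \<le> (gap / 4) * M + (gap / 16) * (4 * M)"
  proof (intro add_mono mult_mono)
    have "\<bar>e j\<bar> \<le> M" for j using M by (simp add: e_def)
    from this[of "i - 1"] this[of i] this[of "i + 1"]
    show "\<bar>e (i - 1) - 2 * e i + e (i + 1)\<bar> \<le> 4 * M" "\<bar>e i\<bar> \<le> M" by linarith+
  qed (use q gap d_le' in \<open>simp_all add: abs_minus_commute\<close>)
  also have "\<dots> = gap * (M / 2)" by (simp add: field_simps)
  also have "\<dots> \<le> \<bar>s\<bar> * (M / 2)" using s M0 by (intro mult_right_mono) auto
  finally show ?thesis using s0 by simp
qed

lemma nagumo_g_root: "w \<in> {0, a, 1} \<Longrightarrow> nagumo_g w a = 0"
  by (auto simp: nagumo_g_def)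

text \<open>The word itself is moved only by the coupling, since \<open>g\<close> vanishes on it.\<close>

lemma newton_maps_near:
  assumes w: "range w \<subseteq> {0, a, 1}" and u: "near w u"
  shows "near w (newton w u)"
  unfolding near_def
proof
  fix i
  have wi: "w j \<in> {0, a, 1}" for j using w by auto
  have w01: "0 \<le> w j" "w j \<le> 1" for j using wi[of j] a by auto
  have "near w w" using radius by (simp add: near_def)
  then have 1: "\<bar>newton w u i - newton w w i\<bar> \<le> radius / 2"
    using u by (intro newton_contraction[OF w]) (auto simp: near_def)
  have s: "gap \<le> \<bar>slope a (w i) (w i)\<bar>" by (rule slope_root(1)[OF wi])
  have "\<bar>w (i - 1) - 2 * w i + w (i + 1)\<bar> \<le> 2"
    using w01[of i] w01[of "i - 1"] w01[of "i + 1"] by linarith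
  then have "d * \<bar>w (i - 1) - 2 * w i + w (i + 1)\<bar> \<le> (gap * radius / 16) * 2"
    using d_pos d_le by (intro mult_mono) auto
  also have "\<dots> \<le> gap * (radius / 2)" using gap radius by simp
  also have "\<dots> \<le> \<bar>slope a (w i) (w i)\<bar> * (radius / 2)"
    using s radius by (intro mult_right_mono) auto
  finally have "\<bar>newton w w i - w i\<bar> \<le> radius / 2"
    using s gap d_pos
    by (simp add: newton_def lattice_rhs_def nagumo_g_root[OF wi] abs_mult pos_divide_le_eq mult.commute)
  then show "\<bar>newton w u i - w i\<bar> \<le> radius" using 1 by linarith
qed

lemma newton_fixed_iff:
  assumes w: "range w \<subseteq> {0, a, 1}"
  shows "newton w u = u \<longleftrightarrow> stationary d a u"
proof -
  have "slope a (w i) (w i) \<noteq> 0" for i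
    using slope_root(1)[of "w i"] w gap by force
  then show ?thesis by (auto simp: newton_def fun_eq_iff stationary_def)
qed

lemma stationary_near_unique:
  assumes w: "range w \<subseteq> {0, a, 1}"
    and u: "stationary d a u" "near w u" and v: "stationary d a v" "near w v"
  shows "u = v"
proof -
  define U V where "U = Bcontfun u" and "V = Bcontfun v"
  have UV: "apply_bcontfun U = u" "apply_bcontfun V = v"
    using near_bcontfun[OF w] u v by (auto simp: U_def V_def Bcontfun_inverse)
  have "\<bar>u i - v i\<bar> \<le> dist U V / 2" for i
  proof -
    have "newton w u = u" "newton w v = v" using newton_fixed_iff[OF w] u v by auto
    moreover have "\<bar>u j - v j\<bar> \<le> dist U V" for j
      using dist_bounded[of U j V] by (simp add: UV dist_real_def)
    ultimately show ?thesis
      using newton_contraction[OF w u(2) v(2), of "dist U V" i] by simp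
  qed
  then have "dist U V \<le> dist U V / 2"
    by (intro dist_bound) (simp add: UV dist_real_def)
  then have "U = V" by simp
  then show ?thesis using UV by simp
qed

lemma stationary_near_exists:
  assumes w: "range w \<subseteq> {0, a, 1}"
  shows "\<exists>u. stationary d a u \<and> near w u"
proof -
  define S where "S = {U :: int \<Rightarrow>\<^sub>C real. near w U}"
  define T where "T U = Bcontfun (newton w (apply_bcontfun U))" for U :: "int \<Rightarrow>\<^sub>C real"
  have T: "apply_bcontfun (T U) = newton w U" if "U \<in> S" for U
    unfolding T_def using that
    by (intro Bcontfun_inverse near_bcontfun[OF w] newton_maps_near[OF w]) (simp add: S_def)
  have "S = PiC UNIV (\<lambda>i. cball (w i) radius)"
    by (auto simp: S_def mem_PiC_iff near_def dist_real_def abs_minus_commute Pi_iff)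
  then have "closed S" by (simp add: closed_PiC)
  then have "complete S" by (simp add: complete_eq_closed)
  moreover have "near w w" using radius by (simp add: near_def)
  then have "Bcontfun w \<in> S" using near_bcontfun[OF w] by (simp add: S_def Bcontfun_inverse)
  moreover have "T ` S \<subseteq> S"
    using newton_maps_near[OF w] by (auto simp: S_def T)
  moreover have "dist (T U) (T V) \<le> 1 / 2 * dist U V" if UV: "U \<in> S" "V \<in> S" for U V
  proof (rule dist_bound)
    have "\<bar>newton w U i - newton w V i\<bar> \<le> dist U V / 2" for i
      by (rule newton_contraction[OF w])
         (use UV dist_bounded[of U _ V] in \<open>auto simp: S_def dist_real_def\<close>)
    then show "dist (T U i) (T V i) \<le> 1 / 2 * dist U V" for i
      using UV by (simp add: T dist_real_def)
  qed
  ultimately obtain U where "U \<in> S" "T U = U"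
    using Banach_fix[of S "1 / 2" T] by auto
  then show ?thesis
    using T newton_fixed_iff[OF w] by (metis S_def mem_Collect_eq)
qed

definition solution :: "(int \<Rightarrow> real) \<Rightarrow> int \<Rightarrow> real" where
  "solution w = (THE u. stationary d a u \<and> near w u)"

lemma solution:
  assumes "range w \<subseteq> {0, a, 1}"
  shows "stationary d a (solution w)" "near w (solution w)"
proof -
  have "\<exists>!u. stationary d a u \<and> near w u"
    using stationary_near_exists[OF assms] stationary_near_unique[OF assms] by blast
  from theI'[OF this] show "stationary d a (solution w)" "near w (solution w)"
    by (simp_all add: solution_def)
qed

lemma solution_eqI:
  assumes "range w \<subseteq> {0, a, 1}" "stationary d a u" "near w u"
  shows "solution w = u"
  using stationary_near_unique solution assms by blast

lemma stationary_translate: "stationary d a u \<Longrightarrow> stationary d a (translate l u)"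
  unfolding stationary_def lattice_rhs_def translate_def
proof
  fix i
  assume "\<forall>i. d * (u (i - 1) - 2 * u i + u (i + 1)) + nagumo_g (u i) a = 0"
  from this[rule_format, of "i + l"]
  show "d * (u (i - 1 + l) - 2 * u (i + l) + u (i + 1 + l)) + nagumo_g (u (i + l)) a = 0"
    by (simp add: algebra_simps)
qed

lemma stationary_reflect: "stationary d a u \<Longrightarrow> stationary d a (reflect u)"
  unfolding stationary_def lattice_rhs_def reflect_def
proof
  fix i
  assume "\<forall>i. d * (u (i - 1) - 2 * u i + u (i + 1)) + nagumo_g (u i) a = 0"
  from this[rule_format, of "1 - i"]
  show "d * (u (1 - (i - 1)) - 2 * u (1 - i) + u (1 - (i + 1))) + nagumo_g (u (1 - i)) a = 0"
    by (simp add: algebra_simps)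
qed

lemma solution_translate:
  assumes "range w \<subseteq> {0, a, 1}"
  shows "solution (translate l w) = translate l (solution w)"
  by (rule solution_eqI)
     (use solution[OF assms] assms in \<open>auto simp: near_def translate_def
       intro!: stationary_translate[unfolded translate_def]\<close>)

lemma solution_reflect:
  assumes "range w \<subseteq> {0, a, 1}"
  shows "solution (reflect w) = reflect (solution w)"
  by (rule solution_eqI)
     (use solution[OF assms] assms in \<open>auto simp: near_def reflect_def
       intro!: stationary_reflect[unfolded reflect_def]\<close>)

lemma solution_inj:
  assumes w: "range w \<subseteq> {0, a, 1}" "range w' \<subseteq> {0, a, 1}" and eq: "solution w = solution w'"
  shows "w = w'"
proof
  fix i
  have "\<bar>solution w i - w i\<bar> \<le> radius" "\<bar>solution w i - w' i\<bar> \<le> radius"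
    using solution(2)[OF w(1)] solution(2)[OF w(2)] eq by (auto simp: near_def)
  then have "\<bar>w i - w' i\<bar> < gap" using radius by linarith
  moreover have "w i \<in> {0, a, 1}" "w' i \<in> {0, a, 1}" using w by auto
  ultimately show "w i = w' i" using gap by auto
qed

text \<open>Discrete maximum principle: at a maximal entry the coupling is not positive, so \<open>g\<close> is not
  negative there, which excludes values above \<open>1\<close>; likewise for minimal entries. Periodicity ensures
  that the extrema are attained.\<close>

lemma periodic_stationary_bounds:
  assumes u: "stationary d a u" "periodic n u" and n: "n > 0"
  shows "0 \<le> u i" "u i \<le> 1"
proof -
  have fin: "finite (range u)" using u n periodic_range_finite by blast
  have eq: "nagumo_g (u j) a = - (d * (u (j - 1) - 2 * u j + u (j + 1)))" for j
    using u(1) by (simp add: stationary_def lattice_rhs_def add_eq_0_iff)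
  show "u i \<le> 1"
  proof (rule ccontr)
    assume "\<not> u i \<le> 1"
    have "Max (range u) \<in> range u" using fin by (intro Max_in) auto
    then obtain j where j: "u j = Max (range u)" by (metis imageE)
    have max: "u k \<le> u j" for k using fin by (simp add: j)
    have uj: "1 < u j" using max[of i] \<open>\<not> u i \<le> 1\<close> by simp
    have "d * (u (j - 1) - 2 * u j + u (j + 1)) \<le> 0"
      using d_pos max[of "j - 1"] max[of "j + 1"] by (intro mult_nonneg_nonpos) auto
    then have "0 \<le> nagumo_g (u j) a" using eq[of j] by simp
    moreover have "nagumo_g (u j) a < 0"
      unfolding nagumo_g_def using uj a by (intro mult_neg_pos[OF mult_pos_neg]) auto
    ultimately show False by simp
  qed
  show "0 \<le> u i"
  proof (rule ccontr)
    assume "\<not> 0 \<le> u i"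
    have "Min (range u) \<in> range u" using fin by (intro Min_in) auto
    then obtain j where j: "u j = Min (range u)" by (metis imageE)
    have min: "u j \<le> u k" for k using fin by (simp add: j)
    have uj: "u j < 0" using min[of i] \<open>\<not> 0 \<le> u i\<close> by simp
    have "0 \<le> d * (u (j - 1) - 2 * u j + u (j + 1))"
      using d_pos min[of "j - 1"] min[of "j + 1"] by (intro mult_nonneg_nonneg) auto
    then have "nagumo_g (u j) a \<le> 0" using eq[of j] by simp
    moreover have "0 < nagumo_g (u j) a"
      unfolding nagumo_g_def using uj a by (intro mult_neg_neg[OF mult_neg_pos]) auto
    ultimately show False by simp
  qed
qed

text \<open>The letter at \<open>i\<close> is chosen as a function of \<open>u i\<close>, so that the word inherits the period of \<open>u\<close>.\<close>

lemma near_some_word: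
  assumes u: "stationary d a u" "periodic n u" and n: "n > 0"
  obtains w where "periodic n w" "range w \<subseteq> {0, a, 1}" "near w u"
proof -
  have "\<exists>r\<in>{0, a, 1}. \<bar>u i - r\<bar> \<le> radius" for i
  proof (rule ccontr)
    assume "\<not> ?thesis"
    then have far: "radius < \<bar>u i\<bar>" "radius < \<bar>1 - u i\<bar>" "radius < \<bar>u i - a\<bar>"
      by (auto simp: abs_minus_commute)
    have "radius * radius * radius \<le> \<bar>u i\<bar> * \<bar>1 - u i\<bar> * \<bar>u i - a\<bar>"
      using far radius by (intro mult_mono) auto
    then have 1: "radius ^ 3 \<le> \<bar>nagumo_g (u i) a\<bar>"
      by (simp add: nagumo_g_def abs_mult power3_eq_cube)
    have "\<bar>u (i - 1) - 2 * u i + u (i + 1)\<bar> \<le> 2"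
      using periodic_stationary_bounds[OF u n, of i] periodic_stationary_bounds[OF u n, of "i - 1"]
        periodic_stationary_bounds[OF u n, of "i + 1"] by linarith
    then have "d * \<bar>u (i - 1) - 2 * u i + u (i + 1)\<bar> \<le> d * 2"
      using d_pos by (intro mult_left_mono) auto
    moreover have "nagumo_g (u i) a = - (d * (u (i - 1) - 2 * u i + u (i + 1)))"
      using u(1) by (simp add: stationary_def lattice_rhs_def add_eq_0_iff)
    ultimately have "\<bar>nagumo_g (u i) a\<bar> \<le> 2 * d"
      using d_pos by (simp add: abs_mult)
    then show False using 1 d_less by simp
  qed
  then have "\<exists>r. \<forall>x\<in>range u. r x \<in> {0, a, 1} \<and> \<bar>x - r x\<bar> \<le> radius"
    by (intro bchoice) blast
  then obtain r where r: "\<And>i. r (u i) \<in> {0, a, 1}" "\<And>i. \<bar>u i - r (u i)\<bar> \<le> radius" by blast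
  show ?thesis
  proof (rule that[of "r \<circ> u"])
    show "periodic n (r \<circ> u)" using u(2) by (simp add: periodic_def)
    show "range (r \<circ> u) \<subseteq> {0, a, 1}" using r(1) by fastforce
    show "near (r \<circ> u) u" using r(2) by (simp add: near_def)
  qed
qed

section \<open>Stability of the continuations\<close>

text \<open>Near a word without the letter \<open>a\<close> all difference quotients \<open>q\<close> lie in \<open>[- 2, - 3 * gap / 4]\<close>. In
  an Euler step of length \<open>1 / 4\<close> the weights \<open>d / 4\<close>, \<open>d / 4\<close> of the neighbours and
  \<open>1 - d / 2 + q / 4\<close> of the entry itself are nonnegative, so their sum \<open>1 + q / 4\<close> bounds the
  Lipschitz constant.\<close>

lemma solution_stable:
  assumes w: "range w \<subseteq> {0, a, 1}" and stable: "\<And>i. w i \<noteq> a"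
    and U: "apply_bcontfun U = solution w"
  shows "asymptotically_stable (nagumo_field d a) U"
proof (rule contraction_step_imp_asymptotically_stable[of "1 / 4" _ _ radius "1 - 3 * gap / 16"])
  show "nagumo_field d a U = 0"
    using solution(1)[OF w] by (simp add: nagumo_field_eq_0_iff U)
  show "1 - 3 * gap / 16 < 1" using gap by simp
  show "(1 - 3 * gap / 16)-lipschitz_on (cball U radius) (\<lambda>X. X + (1 / 4) *\<^sub>R nagumo_field d a X)"
  proof (rule lipschitz_onI)
    fix X Y assume XY: "X \<in> cball U radius" "Y \<in> cball U radius"
    show "dist (X + (1 / 4) *\<^sub>R nagumo_field d a X) (Y + (1 / 4) *\<^sub>R nagumo_field d a Y)
        \<le> (1 - 3 * gap / 16) * dist X Y"
    proof (rule dist_bound)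
      fix i
      have near2: "\<bar>Z i - w i\<bar> \<le> 2 * radius" if "Z \<in> cball U radius" for Z
      proof -
        have "\<bar>Z i - solution w i\<bar> \<le> radius"
          using that dist_bounded[of Z i U] by (simp add: U dist_real_def dist_commute)
        moreover have "\<bar>solution w i - w i\<bar> \<le> radius"
          using solution(2)[OF w] by (simp add: near_def)
        ultimately show ?thesis by linarith
      qed
      have wi: "w i \<in> {0, a, 1}" using w by auto
      define q where "q = slope a (X i) (Y i)"
      define e where "e j = X j - Y j" for j
      have "\<bar>q - slope a (w i) (w i)\<bar> \<le> gap / 4"
        unfolding q_def by (rule slope_near_root[OF wi near2 near2]) fact+
      then have q: "q \<le> - (3 * gap / 4)" "- 2 \<le> q"
        using slope_root(2)[OF wi] slope_root(4)[OF wi stable] gap by linarith+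
      have e: "\<bar>e j\<bar> \<le> dist X Y" for j
        using dist_bounded[of X j Y] by (simp add: e_def dist_real_def)
      have "(X + (1 / 4) *\<^sub>R nagumo_field d a X) i - (Y + (1 / 4) *\<^sub>R nagumo_field d a Y) i
          = e i + (1 / 4) * (lattice_rhs d a X i - lattice_rhs d a Y i)"
        by (simp add: apply_nagumo_field e_def algebra_simps)
      also have "\<dots> = (d / 4) * (e (i - 1) + e (i + 1)) + (1 - d / 2 + q / 4) * e i"
        unfolding lattice_rhs_diff q_def[symmetric] e_def[symmetric] by (simp add: field_simps)
      finally have "dist ((X + (1 / 4) *\<^sub>R nagumo_field d a X) i) ((Y + (1 / 4) *\<^sub>R nagumo_field d a Y) i)
          = \<bar>(d / 4) * (e (i - 1) + e (i + 1)) + (1 - d / 2 + q / 4) * e i\<bar>"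
        by (simp only: dist_real_def)
      also have "\<dots> \<le> (d / 4) * \<bar>e (i - 1) + e (i + 1)\<bar> + (1 - d / 2 + q / 4) * \<bar>e i\<bar>"
        using abs_triangle_ineq[of "(d / 4) * (e (i - 1) + e (i + 1))" "(1 - d / 2 + q / 4) * e i"]
          d_pos d_le' q by (simp add: abs_mult)
      also have "\<dots> \<le> (d / 4) * (2 * dist X Y) + (1 - d / 2 + q / 4) * dist X Y"
      proof (intro add_mono mult_left_mono)
        show "\<bar>e (i - 1) + e (i + 1)\<bar> \<le> 2 * dist X Y"
          using e[of "i - 1"] e[of "i + 1"] by linarith
      qed (use d_pos d_le' q e in auto)
      also have "\<dots> = (1 + q / 4) * dist X Y"
        by (simp add: algebra_simps)
      also have "\<dots> \<le> (1 - 3 * gap / 16) * dist X Y"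
        using q by (intro mult_right_mono) auto
      finally show "dist ((X + (1 / 4) *\<^sub>R nagumo_field d a X) i)
          ((Y + (1 / 4) *\<^sub>R nagumo_field d a Y) i) \<le> (1 - 3 * gap / 16) * dist X Y" .
    qed
  qed (use gap in auto)
qed (use radius in auto)

text \<open>The difference \<open>v\<close> between a solution that starts slightly above \<open>U\<close> and \<open>U\<close> itself stays
  nonnegative by cooperativity. Hence the neighbours can only push \<open>v k\<close> upwards, while the
  difference quotient near the unstable zero makes it grow at least like \<open>exp (gap t / 2)\<close>.\<close>

lemma solution_unstable:
  assumes w: "range w \<subseteq> {0, a, 1}" and k: "w k = a"
    and U: "apply_bcontfun U = solution w"
  shows "\<not> lyapunov_stable (nagumo_field d a) U"
proof
  assume "lyapunov_stable (nagumo_field d a) U"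
  then obtain \<delta> where \<delta>: "\<delta> > 0" "\<And>x0. norm (x0 - U) < \<delta> \<Longrightarrow>
        (\<exists>x. solves_from (nagumo_field d a) x0 x) \<and>
        (\<forall>x. solves_from (nagumo_field d a) x0 x \<longrightarrow> (\<forall>t\<ge>0. norm (x t - U) < radius))"
    unfolding lyapunov_stable_def using radius(1) by metis
  \<comment> \<open>A positive constant perturbation lies in the cone that the flow preserves.\<close>
  define x0 where "x0 = U + const_bcontfun (\<delta> / 2)"
  have "norm (x0 - U) \<le> \<delta> / 2"
    using \<delta>(1) by (intro norm_bound) (simp add: x0_def)
  then have "norm (x0 - U) < \<delta>" using \<delta>(1) by simp
  then obtain x where x: "solves_from (nagumo_field d a) x0 x"
    and close: "\<And>t. 0 \<le> t \<Longrightarrow> norm (x t - U) < radius" using \<delta>(2) by blast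
  define v where "v t = x t - U" for t
  define q where "q t i = slope a (x t i) (U i)" for t i
  have near: "\<bar>x t i - w i\<bar> \<le> 2 * radius" "\<bar>U i - w i\<bar> \<le> 2 * radius" if "0 \<le> t" for t i
  proof -
    have "\<bar>x t i - U i\<bar> \<le> radius"
      using close[OF that] norm_bounded[of "x t - U" i] by simp
    moreover have "\<bar>U i - w i\<bar> \<le> radius"
      using solution(2)[OF w] by (simp add: near_def U)
    ultimately show "\<bar>x t i - w i\<bar> \<le> 2 * radius" "\<bar>U i - w i\<bar> \<le> 2 * radius" using radius by linarith+
  qed
  have qnear: "\<bar>q t i - slope a (w i) (w i)\<bar> \<le> gap / 4" if "0 \<le> t" for t i
    unfolding q_def by (rule slope_near_root) (use w near[OF that] in auto)
  have dv: "((\<lambda>s. v s i) has_real_derivative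
      d * (v t (i - 1) + v t (i + 1)) + (q t i - 2 * d) * v t i) (at t within {0..})"
    if "0 \<le> t" for t i
  proof -
    have "(x has_vector_derivative nagumo_field d a (x t)) (at t within {0..})"
      using x that by (simp add: solves_from_def)
    then have "(v has_vector_derivative nagumo_field d a (x t)) (at t within {0..})"
      unfolding v_def by (auto intro!: derivative_eq_intros)
    then have "((\<lambda>s. v s i) has_real_derivative lattice_rhs d a (x t) i) (at t within {0..})"
      using has_real_derivative_apply_bcontfun[of v "nagumo_field d a (x t)" t "{0..}" i]
      by (simp add: apply_nagumo_field)
    moreover have "lattice_rhs d a U i = 0"
      using solution(1)[OF w] by (simp add: U stationary_def)
    then have "lattice_rhs d a (x t) i
        = d * (v t (i - 1) + v t (i + 1)) + (q t i - 2 * d) * v t i"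
      using lattice_rhs_diff[of d a "x t" i U] by (simp add: v_def q_def)
    ultimately show ?thesis by simp
  qed
  have v0: "v 0 i = \<delta> / 2" for i
    using x by (simp add: solves_from_def v_def x0_def)
  have pos: "0 \<le> v t i" if "0 \<le> t" for t i
  proof (rule cooperative_nonneg[of v d "\<lambda>t i. q t i - 2 * d" 3])
    show "continuous_on {0..} v"
      unfolding v_def using solves_from_continuous[OF x] by (intro continuous_intros)
    show "\<bar>q t i - 2 * d\<bar> \<le> 3" if "0 \<le> t" for t i
    proof -
      have "\<bar>slope a (w i) (w i)\<bar> \<le> 1" using w by (intro slope_root(2)) auto
      then show ?thesis using qnear[OF that, of i] gap d_le' d_pos by linarith
    qed
  qed (use dv d_pos \<delta>(1) that in \<open>simp_all add: v0\<close>)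
  have grow: "\<delta> / 2 * exp (gap / 2 * t) \<le> v t k" if t: "0 \<le> t" for t
  proof -
    define y where "y s = exp (- (gap / 2 * s)) * v s k" for s
    have "y 0 \<le> y t"
    proof (rule nondecreasing_from_zero[of y])
      show "(y has_real_derivative exp (- (gap / 2 * s)) *
          (d * (v s (k - 1) + v s (k + 1)) + (q s k - 2 * d - gap / 2) * v s k)) (at s within {0..})"
        if "0 \<le> s" for s
        unfolding y_def using dv[OF that, of k]
        by (auto intro!: derivative_eq_intros simp: algebra_simps)
      fix s assume s: "0 < s" "s < t"
      have "\<bar>q s k - gap\<bar> \<le> gap / 4"
        using qnear[of s k] slope_root(3)[of "w k"] k s by simp
      then have "0 \<le> q s k - 2 * d - gap / 2" using d_le' by linarith
      then show "0 \<le> exp (- (gap / 2 * s)) *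
          (d * (v s (k - 1) + v s (k + 1)) + (q s k - 2 * d - gap / 2) * v s k)"
        using pos s d_pos by (intro mult_nonneg_nonneg add_nonneg_nonneg) auto
    qed fact
    then show ?thesis by (simp add: y_def v0 exp_minus field_simps)
  qed
  \<comment> \<open>At this time the lower bound for \<open>v t k\<close> has reached \<open>radius + \<delta> / 2\<close>.\<close>
  define t where "t = 2 / gap * ln (2 * radius / \<delta> + 1)"
  have "0 < 2 * radius / \<delta>" using radius(1) \<delta>(1) by simp
  then have t: "0 \<le> t" "exp (gap / 2 * t) = 2 * radius / \<delta> + 1"
    using gap(1) by (auto simp: t_def)
  have "radius < v t k"
  proof -
    have "\<delta> / 2 * (2 * radius / \<delta> + 1) = radius + \<delta> / 2"
      using \<delta>(1) by (simp add: field_simps)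
    then show ?thesis
      using grow[OF t(1)] \<delta>(1) unfolding t(2) by linarith
  qed
  moreover have "v t k < radius"
    using close[OF t(1)] norm_bounded[of "v t" k] by (simp add: v_def)
  ultimately show False by simp
qed

section \<open>Classification of the periodic stationary solutions\<close>

lemma solution_periodic:
  assumes "w \<in> words {0, a, 1} n"
  shows "periodic n (solution w)"
  using assms solution_translate[of w "int n"] by (simp add: words_def periodic_iff_translate)

lemma periodic_stationary_eq:
  assumes n: "n > 0"
  shows "periodic_stationary d a n = solution ` words {0, a, 1} n"
proof (intro Set.set_eqI iffI)
  fix u assume "u \<in> periodic_stationary d a n"
  then have u: "stationary d a u" "periodic n u" by (auto simp: periodic_stationary_def)
  obtain w where w: "periodic n w" "range w \<subseteq> {0, a, 1}" "near w u"
    using near_some_word[OF u n] .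
  then show "u \<in> solution ` words {0, a, 1} n"
    using solution_eqI[OF w(2) u(1) w(3)] by (auto simp: words_def intro!: image_eqI[of _ _ w])
next
  fix u assume "u \<in> solution ` words {0, a, 1} n"
  then obtain w where w: "w \<in> words {0, a, 1} n" "u = solution w" by blast
  then show "u \<in> periodic_stationary d a n"
    using solution(1)[of w] solution_periodic[OF w(1)]
    by (simp add: periodic_stationary_def words_def)
qed

lemma stable_periodic_stationary_eq:
  assumes n: "n > 0"
  shows "stable_periodic_stationary d a n = solution ` words {0, 1} n"
proof (intro Set.set_eqI iffI)
  fix u assume "u \<in> stable_periodic_stationary d a n"
  then obtain w U where w: "w \<in> words {0, a, 1} n" "u = solution w"
    and U: "apply_bcontfun U = u" "lyapunov_stable (nagumo_field d a) U"
    unfolding stable_periodic_stationary_def periodic_stationary_eq[OF n] asymptotically_stable_def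
    by blast
  have "w k \<noteq> a" for k
    using solution_unstable[of w k U] w U by (auto simp: words_def)
  then have "w \<in> words {0, 1} n"
    using w(1) by (auto simp: words_def)
  then show "u \<in> solution ` words {0, 1} n" using w(2) by blast
next
  fix u assume "u \<in> solution ` words {0, 1} n"
  then obtain w where w: "w \<in> words {0, 1} n" "u = solution w" by blast
  then have w3: "w \<in> words {0, a, 1} n" by (auto simp: words_def)
  then have range: "range w \<subseteq> {0, a, 1}" by (simp add: words_def)
  have "w i \<noteq> a" for i
  proof -
    have "w i \<in> {0, 1}" using w(1) by (auto simp: words_def)
    then show ?thesis using a by auto
  qed
  moreover have "apply_bcontfun (Bcontfun u) = u"
    using near_bcontfun[OF range solution(2)[OF range]] by (simp add: w(2) Bcontfun_inverse)
  ultimately have "asymptotically_stable (nagumo_field d a) (Bcontfun u)"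
    using solution_stable[OF range] w(2) by simp
  moreover have "u \<in> periodic_stationary d a n"
    unfolding periodic_stationary_eq[OF n] using w(2) w3 by blast
  ultimately show "u \<in> stable_periodic_stationary d a n"
    unfolding stable_periodic_stationary_def using \<open>apply_bcontfun (Bcontfun u) = u\<close> by blast
qed

lemma solution_class_counts:
  assumes A: "A \<subseteq> {0, a, 1}" and n: "n > 0" and S: "S = solution ` words A n"
  shows "card S = card A ^ n"
    and "real (card (S // trans_rel S)) = necklaces (card A) n"
    and "real (card (primitive_classes n (S // trans_rel S))) = lyndon_words (card A) n"
    and "real (card (S // trans_refl_rel S)) = bracelets (card A) n"
    and "real (card (primitive_classes n (S // trans_refl_rel S))) = lyndon_bracelets (card A) n"
proof -
  have range: "range w \<subseteq> {0, a, 1}" if "w \<in> words A n" for w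
    using that A by (auto simp: words_def)
  have fin: "finite A" using A by (rule finite_subset) simp
  have inj: "inj_on solution (words A n)"
    using solution_inj range by (intro inj_onI) blast
  have "solution (translate l w) = translate l (solution w)" "solution (reflect w) = reflect (solution w)"
    if "w \<in> words A n" for l w
    using solution_translate[OF range[OF that]] solution_reflect[OF range[OF that]] by auto
  note counts = class_counts[OF fin n inj this S]
  show "card S = card A ^ n"
    "real (card (S // trans_rel S)) = necklaces (card A) n"
    "real (card (primitive_classes n (S // trans_rel S))) = lyndon_words (card A) n"
    "real (card (S // trans_refl_rel S)) = bracelets (card A) n"
    "real (card (primitive_classes n (S // trans_refl_rel S))) = lyndon_bracelets (card A) n"
    using counts by simp_all
qed

end

theorem theorem4:
  fixes n :: nat and a :: real
  assumes "n \<ge> 2" and "0 < a" and "a < 1"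
  shows "\<exists>d0>0. \<forall>d::real. 0 < d \<and> d < d0 \<longrightarrow>
    (let S = periodic_stationary d a n; T = stable_periodic_stationary d a n in
      card S = 3 ^ n \<and>
      real (card (S // trans_rel S)) = necklaces 3 n \<and>
      real (card (primitive_classes n (S // trans_rel S))) = lyndon_words 3 n \<and>
      real (card (S // trans_refl_rel S)) = bracelets 3 n \<and>
      real (card (primitive_classes n (S // trans_refl_rel S))) = lyndon_bracelets 3 n \<and>
      card T = 2 ^ n \<and>
      real (card (T // trans_rel T)) = necklaces 2 n \<and>
      real (card (primitive_classes n (T // trans_rel T))) = lyndon_words 2 n \<and>
      real (card (T // trans_refl_rel T)) = bracelets 2 n \<and>
      real (card (primitive_classes n (T // trans_refl_rel T))) = lyndon_bracelets 2 n)"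
proof (intro exI[of _ "(a * (1 - a) / 56) ^ 3 / 2"] conjI allI impI)
  show "0 < (a * (1 - a) / 56) ^ 3 / 2" using assms by simp
  fix d assume d: "0 < d \<and> d < (a * (1 - a) / 56) ^ 3 / 2"
  then interpret weak_coupling a d
    using assms by unfold_locales auto
  have n: "n > 0" using assms by simp
  have cards: "card {0, a, 1} = 3" "card {0, 1 :: real} = 2" using assms by auto
  show "let S = periodic_stationary d a n; T = stable_periodic_stationary d a n in
      card S = 3 ^ n \<and>
      real (card (S // trans_rel S)) = necklaces 3 n \<and>
      real (card (primitive_classes n (S // trans_rel S))) = lyndon_words 3 n \<and>
      real (card (S // trans_refl_rel S)) = bracelets 3 n \<and>
      real (card (primitive_classes n (S // trans_refl_rel S))) = lyndon_bracelets 3 n \<and>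
      card T = 2 ^ n \<and>
      real (card (T // trans_rel T)) = necklaces 2 n \<and>
      real (card (primitive_classes n (T // trans_rel T))) = lyndon_words 2 n \<and>
      real (card (T // trans_refl_rel T)) = bracelets 2 n \<and>
      real (card (primitive_classes n (T // trans_refl_rel T))) = lyndon_bracelets 2 n"
    using solution_class_counts[OF _ n periodic_stationary_eq[OF n]]
      solution_class_counts[OF _ n stable_periodic_stationary_eq[OF n]]
    by (simp add: Let_def cards)
qed

end
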